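(* Let $g:[0,1]\to\mathbb{R}$ be differentiable on $[0,1]$ with derivative $g'$ that is $\beta$-Hölder continuous for some $\beta\in(0,1]$. For each $n\ge 1$ let $\mathbf{P}_n=\{p_{n,i}\}_{i\ge 1}$ be a probability distribution on a countably infinite alphabet $\mathcal{A}=\{a_i : i\ge 1\}$ (some $p_{n,i}$, even infinitely many, may be zero) with $\sum_{i=1}^\infty |g(p_{n,i})|<\infty$, and let $X_{1,n},\dots,X_{n,n}$ be independent and identically distributed $\mathcal{A}$-valued random variables with common distribution $\mathbf{P}_n$, i.e. $\mathbb{P}(X_{1,n}=a_i)=p_{n,i}$. Put $$\theta_n=\sum_{i=1}^\infty g(p_{n,i}),\qquad \hat p_{n,i}=\frac1n\sum_{k=1}^n I_{\{X_{k,n}=a_i\}},\qquad \hat\theta_n=\sum_{i=1}^\infty g(\hat p_{n,i}),$$ $$\sigma_n^2=\sum_{i=1}^\infty p_{n,i}\,(g'(p_{n,i}))^2-\Big(\sum_{i=1}^\infty p_{n,i}\,g'(p_{n,i})\Big)^2,\qquad \sigma_n\ge 0,$$ and $$\gamma=\begin{cases}\beta/2 & \text{if } \beta\in(0,0.5],\\ \beta-0.5 & \text{if } \beta\in(0.5,1].\end{cases}$$ Suppose that either (1) $\beta\in(0.5,1]$, or (2) $\beta\in(0,0.5]$ and $\sup_n\sum_{i=1}^\infty p_{n,i}^{(\beta+1)/2}<\infty$. Then there is a constant $C>0$, not depending on $n$, such that for every $n\ge 1$ with $\sigma_n>0$, $$\sup_{x\in\mathbb{R}}\left|\mathbb{P}\left(\frac{\sqrt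 n}{\sigma_n}(\hat\theta_n-\theta_n)\le x\right)-\Phi(x)\right|\le \frac{C}{n^{\gamma/2}\sigma_n^{1/2}},$$ where $\Phi$ is the standard normal distribution function.
   Context: A function $f:[0,1]\to\mathbb{R}$ is called $\beta$-Hölder continuous, for $\beta\in(0,1]$, if there is a constant $M>0$ with $|f(x)-f(y)|\le M|x-y|^\beta$ for all $x,y\in[0,1]$. Derivatives at the endpoints $0$ and $1$ are one-sided. $I_A$ denotes the indicator of the event $A$. *)

theory Defs
  imports "HOL-Probability.Probability"
begin

definition holder_on :: "real \<Rightarrow> real set \<Rightarrow> (real \<Rightarrow> real) \<Rightarrow> bool" where
  "holder_on \<beta> S f \<longleftrightarrow>
     0 < \<beta> \<and> \<beta> \<le> 1 \<and> (\<exists>M>0. \<forall>x\<in>S. \<forall>y\<in>S. \<bar>f x - f y\<bar> \<le> M * \<bar>x - y\<bar> powr \<beta>)"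

text \<open>Letter probabilities are indexed from 0: p i is the probability of the letter
  a i, for every natural number i.\<close>

definition additive_functional :: "(real \<Rightarrow> real) \<Rightarrow> (nat \<Rightarrow> real) \<Rightarrow> real" where
  "additive_functional g p = (\<Sum>i. g (p i))"

text \<open>The sample has size n and consists of X 1 up to X n.\<close>

definition emp_prob :: "(nat \<Rightarrow> 'a) \<Rightarrow> nat \<Rightarrow> (nat \<Rightarrow> 'w \<Rightarrow> 'a) \<Rightarrow> 'w \<Rightarrow> nat \<Rightarrow> real" where
  "emp_prob a n X \<omega> i = (1 / real n) * (\<Sum>k=1..n. indicator {\<omega>. X k \<omega> = a i} \<omega>)"

text \<open>If g is continuous at 0 and \<Sum>i. g (p i) converges, then g 0 = 0, so
  that only finitely many terms of the following series are nonzero.\<close>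

definition plug_in :: "(real \<Rightarrow> real) \<Rightarrow> (nat \<Rightarrow> 'a) \<Rightarrow> nat \<Rightarrow> (nat \<Rightarrow> 'w \<Rightarrow> 'a) \<Rightarrow> 'w \<Rightarrow> real" where
  "plug_in g a n X \<omega> = additive_functional g (emp_prob a n X \<omega>)"

text \<open>The argument g' is the derivative of g.\<close>

definition asymp_sd :: "(real \<Rightarrow> real) \<Rightarrow> (nat \<Rightarrow> real) \<Rightarrow> real" where
  "asymp_sd g' p = sqrt ((\<Sum>i. p i * (g' (p i))\<^sup>2) - (\<Sum>i. p i * g' (p i))\<^sup>2)"

definition rate_exponent :: "real \<Rightarrow> real" where
  "rate_exponent \<beta> = (if \<beta> \<le> 1/2 then \<beta> / 2 else \<beta> - 1/2)"

end

theory Submission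
  imports Defs
begin

text \<open>By Taylor expansion at the true probabilities, the normalised estimation error is a
  normalised sum of independent bounded variables plus a remainder dominated by the sum over
  all letters of the deviations of the empirical frequencies to the power 1 + \<beta>.
  Interpolating between the first two moments of these deviations shows that the normalised
  remainder has first absolute moment of order n powr (-\<gamma>) / \<sigma>. Stein's method compares sum
  and remainder with the normal law on (1/\<delta>)-Lipschitz approximations of half-line indicators,
  at a cost of order n powr (-\<gamma>) / (\<sigma> \<delta>), while the approximation itself costs \<delta>. The choice
  \<delta>^2 = n powr (-\<gamma>) / \<sigma> balances the two errors. No Berry-Esseen theorem is needed, because
  the rate is only the square root of the Berry-Esseen one.\<close>

subsection \<open>Stein's method for the standard normal distribution\<close>

text \<open>The remainder is built from the same sample as the linear term, so it cannot be treated
  as independent noise; a Lipschitz test function sees it only through its mean absolute value. The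
  price is that the Stein solution of such a function has no second derivative to expand. The two
  values of \<gamma> come from two bounds on the moment of order 1 + \<beta> of one deviation. The
  bound 3 n^(-\<beta>) p_i sums over any alphabet because the p_i add up to 1; the factor sqrt n
  turns it into n^(1/2 - \<beta>), which decays only for \<beta> > 1/2. The bound 2 (p_i / n)^((1 +
  \<beta>) / 2) leads to n^(-\<beta>/2), but its sum over the letters must be controlled, hence the
  extra hypothesis for small \<beta>. In both regimes \<gamma> <= 1/2, so the Stein error of the
  bounded summands, of order n^(-1/2) / \<sigma> before smoothing, is absorbed by n^(-\<gamma>) /
  \<sigma>. Moments are extended nonnegative integrals, so that expectation and sum over infinitely
  many letters commute without integrability conditions.\<close>

lemma DERIV_std_normal_density:
  "(std_normal_density has_real_derivative - x * std_normal_density x) (at x)"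
  unfolding std_normal_density_def[abs_def]
  by (auto intro!: derivative_eq_intros simp: field_simps)

lemma continuous_on_std_normal_density: "continuous_on A std_normal_density"
  unfolding std_normal_density_def[abs_def] by (intro continuous_intros) simp

lemma std_normal_density_pos: "0 < std_normal_density x"
  by (simp add: normal_density_pos)

lemma std_normal_density_le_1: "std_normal_density x \<le> 1"
proof -
  have "1 \<le> sqrt (2 * pi)" using pi_ge_two by simp
  then show ?thesis unfolding std_normal_density_def
    by (intro mult_le_one) auto
qed

text \<open>Origin of the constant 5 that bounds the Stein solution: 2 * pi * e is at most 24, hence
  below 5^2.\<close>

lemma std_normal_density_1_ge: "1 / 5 \<le> std_normal_density 1"
proof -
  have "sqrt (2 * pi) * exp (1 / 2) = sqrt (2 * pi * exp 1)"
    by (simp add: real_sqrt_mult flip: powr_half_sqrt) (simp add: powr_def)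
  also have "\<dots> \<le> sqrt (5 * 5)"
  proof -
    have "2 * pi * exp 1 \<le> 2 * 4 * (3::real)"
      using pi_less_4 exp_le by (intro mult_mono) auto
    then show ?thesis by (intro real_sqrt_le_mono) simp
  qed
  finally have "sqrt (2 * pi) * exp (1 / 2) \<le> 5" by simp
  then show ?thesis
    by (simp add: std_normal_density_def exp_minus field_simps)
qed

lemma std_normal_density_antimono:
  assumes "\<bar>x\<bar> \<le> \<bar>y\<bar>" shows "std_normal_density y \<le> std_normal_density x"
proof -
  have "x\<^sup>2 \<le> y\<^sup>2" using assms by (simp add: abs_le_square_iff)
  then show ?thesis unfolding std_normal_density_def by (intro mult_left_mono) auto
qed

lemma tendsto_std_normal_density_at_top: "(std_normal_density \<longlongrightarrow> 0) at_top"
proof -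
  have "((\<lambda>x::real. (1 / sqrt (2 * pi)) * exp (- x\<^sup>2 / 2)) \<longlongrightarrow> 0) at_top"
    by real_asymp
  then show ?thesis by (simp add: std_normal_density_def[abs_def])
qed

section \<open>Normal tails and the Stein equation\<close>

interpretation std_normal: prob_space std_normal_distribution
  by (rule prob_space_normal_density) simp

text \<open>Under the tail integral the factor w is at most the integration variable x, and x times
  the density is minus the derivative of the density, so it integrates exactly.\<close>

lemma mills_upper:
  assumes "0 \<le> w"
  shows "w * measure std_normal_distribution {w..} \<le> std_normal_density w"
proof -
  have "ennreal w * emeasure std_normal_distribution {w..}
      = (\<integral>\<^sup>+x. ennreal w * (ennreal (std_normal_density x) * indicator {w..} x) \<partial>lborel)"
    by (simp add: emeasure_density nn_integral_cmult)
  also have "\<dots> \<le> (\<integral>\<^sup>+x. ennreal (x * std_normal_density x) * indicator {w..} x \<partial>lborel)"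
    using assms by (intro nn_integral_mono)
      (auto simp: indicator_def ennreal_mult'[symmetric] intro!: ennreal_leI mult_right_mono)
  also have "\<dots> = 0 - (- std_normal_density w)"
  proof (rule nn_integral_FTC_atLeast)
    show "((\<lambda>a. - std_normal_density a) has_real_derivative x * std_normal_density x) (at x)" for x
      using DERIV_minus[OF DERIV_std_normal_density[of x]] by simp
    show "((\<lambda>a. - std_normal_density a) \<longlongrightarrow> 0) at_top"
      using tendsto_minus[OF tendsto_std_normal_density_at_top] by simp
  qed (use assms in auto)
  finally have "ennreal (w * measure std_normal_distribution {w..}) \<le> ennreal (std_normal_density w)"
    using assms by (simp add: std_normal.emeasure_eq_measure ennreal_mult)
  then show ?thesis by (simp add: ennreal_le_iff)
qed

lemma std_normal_reflect:
  "measure std_normal_distribution {..- w} = measure std_normal_distribution {w..}"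
proof -
  have "emeasure std_normal_distribution {..- w}
      = (\<integral>\<^sup>+x. ennreal (std_normal_density x) * indicator {..- w} x \<partial>lborel)"
    by (simp add: emeasure_density)
  also have "\<dots> = (\<integral>\<^sup>+x. ennreal (std_normal_density (- x)) * indicator {..- w} (- x) \<partial>lborel)"
    by (subst nn_integral_real_affine[where c="-1" and t=0]) auto
  also have "\<dots> = (\<integral>\<^sup>+x. ennreal (std_normal_density x) * indicator {w..} x \<partial>lborel)"
    by (intro nn_integral_cong) (auto simp: indicator_def std_normal_density_def)
  also have "\<dots> = emeasure std_normal_distribution {w..}"
    by (simp add: emeasure_density)
  finally show ?thesis by (simp add: measure_def)
qed

text \<open>Requiring F to lie below both tails handles either sign of w: by symmetry F is below the
  tail beyond \<open>\<bar>w\<bar>\<close>. For the second bound, F <= 1 suffices where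
  \<open>\<bar>w\<bar> \<le> 1\<close>, since the density there is at least its value at 1;
  elsewhere the first bound is already stronger. Division by the density at w will give the bounds
  on w * f w and f w for the Stein solution f.\<close>

lemma mills_bound:
  assumes F: "F \<le> measure std_normal_distribution {w..}" "F \<le> measure std_normal_distribution {..w}"
  shows "\<bar>w\<bar> * F \<le> std_normal_density w" "F \<le> std_normal_density w / std_normal_density 1"
proof -
  have *: "F \<le> measure std_normal_distribution {\<bar>w\<bar>..}"
    using F std_normal_reflect[of "- w"] by (cases "w \<ge> 0") auto
  have "\<bar>w\<bar> * F \<le> \<bar>w\<bar> * measure std_normal_distribution {\<bar>w\<bar>..}"
    using * by (intro mult_left_mono) auto
  also have "\<dots> \<le> std_normal_density \<bar>w\<bar>" by (rule mills_upper) simp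
  finally show 1: "\<bar>w\<bar> * F \<le> std_normal_density w" by (simp add: std_normal_density_def)
  note pos = std_normal_density_pos
  have F1: "F \<le> 1" using * std_normal.prob_le_1 order_trans by blast
  show "F \<le> std_normal_density w / std_normal_density 1"
  proof (cases "\<bar>w\<bar> \<le> 1")
    case True
    then have "1 \<le> std_normal_density w / std_normal_density 1"
      using std_normal_density_antimono[of w 1] pos[of 1] by (simp add: le_divide_eq)
    then show ?thesis using F1 by linarith
  next
    case False
    have "F \<le> std_normal_density w"
    proof (cases "F \<le> 0")
      case True
      then show ?thesis using pos[of w] by linarith
    next
      case F0: False
      have "1 * F \<le> \<bar>w\<bar> * F" using False F0 by (intro mult_right_mono) auto
      then show ?thesis using 1 by linarith
    qed
    also have "\<dots> \<le> std_normal_density w / std_normal_density 1"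
      using std_normal_density_le_1[of 1] pos by (simp add: le_divide_eq)
    finally show ?thesis .
  qed
qed

text \<open>The normal density \<phi> is an integrating factor: f' w - w * f w = h w - c is
  equivalent to (f * \<phi>)' = (h - c) * \<phi>. Integrating from minus infinity picks the bounded
  solution. The bound 2 on f' is read off the equation, as w * f w and h w - c are both at most 1 in
  absolute value.\<close>

lemma stein_solution:
  fixes h :: "real \<Rightarrow> real"
  assumes cont: "continuous_on UNIV h" and h01: "\<And>x. 0 \<le> h x" "\<And>x. h x \<le> 1"
  shows "\<exists>f f'. (\<forall>w. (f has_real_derivative f' w) (at w)) \<and>
    (\<forall>w. f' w = w * f w + h w - (\<integral>x. h x \<partial>std_normal_distribution)) \<and>
    (\<forall>w. \<bar>f w\<bar> \<le> 5) \<and> (\<forall>w. \<bar>f' w\<bar> \<le> 2)"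
proof -
  define \<phi> where "\<phi> = std_normal_density"
  define c where "c = (\<integral>x. h x \<partial>std_normal_distribution)"
  define q where "q t = (h t - c) * \<phi> t" for t
  define F where "F w = (LINT t:{..w}|lborel. q t)" for w
  have \<phi>_pos: "0 < \<phi> x" for x by (simp add: \<phi>_def std_normal_density_pos)
  have [measurable]: "h \<in> borel_measurable borel"
    using cont by (rule borel_measurable_continuous_onI)
  have [measurable]: "\<phi> \<in> borel_measurable borel" by (simp add: \<phi>_def)
  have int_h: "integrable std_normal_distribution h"
    using h01 by (intro std_normal.integrable_const_bound[where B=1]) auto
  have c01: "0 \<le> c" "c \<le> 1" unfolding c_def using h01
    by (auto intro!: integral_nonneg std_normal.integral_le_const int_h)
  have hc: "\<bar>h t - c\<bar> \<le> 1" for t using h01[of t] c01 by linarith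
  have int_\<phi>: "integrable lborel \<phi>" unfolding \<phi>_def by (rule integrable_normal_density) simp
  have q_bd: "\<bar>q t\<bar> \<le> \<phi> t" for t
    using mult_right_mono[OF hc, of "\<phi> t" t] \<phi>_pos[of t] by (simp add: q_def abs_mult)
  have int_q: "integrable lborel q"
  proof (rule Bochner_Integration.integrable_bound[OF int_\<phi>])
    show "q \<in> borel_measurable lborel" unfolding q_def[abs_def] by simp
    show "AE x in lborel. norm (q x) \<le> norm (\<phi> x)"
      using order_trans[OF q_bd abs_ge_self] by simp
  qed
  have set_int: "set_integrable lborel A q" "set_integrable lborel A \<phi>" if "A \<in> sets borel" for A
    using that unfolding set_integrable_def
    by (auto simp del: real_scaleR_def intro!: integrable_mult_indicator int_q int_\<phi>)
  have cont_q: "continuous_on A q" for A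
    unfolding q_def[abs_def] \<phi>_def
    by (intro continuous_intros continuous_on_std_normal_density continuous_on_subset[OF cont]) auto
  have measure_eq: "measure std_normal_distribution A = (LINT t:A|lborel. \<phi> t)" if "A \<in> sets borel" for A
  proof -
    have "measure std_normal_distribution A = (\<integral>t. indicator A t \<partial>std_normal_distribution)"
      using that by simp
    also have "\<dots> = (LINT t:A|lborel. \<phi> t)"
      using that unfolding set_lebesgue_integral_def \<phi>_def
      by (subst integral_density) (auto simp: mult.commute)
    finally show ?thesis .
  qed
  have abs_set: "\<bar>LINT t:A|lborel. q t\<bar> \<le> measure std_normal_distribution A" if "A \<in> sets borel" for A
  proof -
    have "\<bar>LINT t:A|lborel. q t\<bar> \<le> (LINT t:A|lborel. \<bar>q t\<bar>)"
      using set_integral_norm_bound[OF set_int(1)[OF that]] by simp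
    also have "\<dots> \<le> (LINT t:A|lborel. \<phi> t)"
      using that q_bd by (intro set_integral_mono set_int) (auto intro!: set_integrable_abs set_int)
    finally show ?thesis using measure_eq[OF that] by simp
  qed
  \<comment> \<open>Centring at c makes the total integral vanish, so F w is also minus the integral
    over the right tail. This keeps F as small as the right tail for large w, where division by the
    density would otherwise blow up.\<close>
  have q0: "(LINT t|lborel. q t) = 0"
  proof -
    have "(LINT t|lborel. q t) = (\<integral>t. h t - c \<partial>std_normal_distribution)"
      unfolding q_def \<phi>_def by (subst integral_density) (auto simp: mult.commute)
    also have "\<dots> = 0" using int_h
      using std_normal.prob_space by (simp add: c_def)
    finally show ?thesis .
  qed
  have F_le: "\<bar>F w\<bar> \<le> measure std_normal_distribution {..w}" 
    "\<bar>F w\<bar> \<le> measure std_normal_distribution {w..}" for w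
  proof -
    show "\<bar>F w\<bar> \<le> measure std_normal_distribution {..w}" unfolding F_def by (rule abs_set) simp
    have "(LINT t:{..w} \<union> {w<..}|lborel. q t) = F w + (LINT t:{w<..}|lborel. q t)"
      unfolding F_def by (intro set_integral_Un set_int) auto
    moreover have "{..w} \<union> {w<..} = UNIV" by auto
    ultimately have "F w = - (LINT t:{w<..}|lborel. q t)" using q0 
      by (simp add: set_lebesgue_integral_def)
    then have "\<bar>F w\<bar> \<le> measure std_normal_distribution {w<..}" using abs_set[of "{w<..}"] by simp
    also have "\<dots> \<le> measure std_normal_distribution {w..}"
      by (intro std_normal.finite_measure_mono) auto
    finally show "\<bar>F w\<bar> \<le> measure std_normal_distribution {w..}" .
  qed
  \<comment> \<open>Near w, F differs by a constant from the integral with fixed lower limit w - 1,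
    so the fundamental theorem on a compact interval applies.\<close>
  have dF: "(F has_real_derivative q w) (at w)" for w
  proof -
    have eq: "F (w - 1) + integral {w - 1..u} q = F u" if "u \<in> {w-1<..<w+1}" for u
    proof -
      have "(LINT t:{..w - 1} \<union> {w - 1<..u}|lborel. q t) = F (w-1) + (LINT t:{w - 1<..u}|lborel. q t)"
        unfolding F_def by (intro set_integral_Un set_int) auto
      moreover have "{..w - 1} \<union> {w - 1<..u} = {..u}" using that by auto
      moreover have "(LINT t:{w - 1<..u}|lborel. q t) = integral {w - 1<..u} q"
        by (intro set_borel_integral_eq_integral set_int) auto
      moreover have "integral {w - 1<..u} q = integral {w - 1..u} q"
        by (intro integral_subset_negligible negligible_subset[OF negligible_sing[of "w - 1"]]) auto
      ultimately show ?thesis by (simp add: F_def)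
    qed
    have "((\<lambda>u. integral {w - 1..u} q) has_real_derivative q w) (at w within {w-1..w+1})"
      by (rule integral_has_real_derivative[OF cont_q]) simp
    then have "((\<lambda>u. integral {w - 1..u} q) has_real_derivative q w) (at w)"
      by (simp add: at_within_Icc_at)
    then have "((\<lambda>u. F (w - 1) + integral {w - 1..u} q) has_real_derivative q w) (at w)"
      by (auto intro!: derivative_eq_intros)
    then show ?thesis
      by (rule has_field_derivative_transform_within_open[where S="{w-1<..<w+1}"]) (auto intro: eq)
  qed
  define f where "f w = F w / \<phi> w" for w
  define f' where "f' w = w * f w + h w - c" for w
  have df: "(f has_real_derivative f' w) (at w)" for w
    unfolding f_def[abs_def] f'_def
    using dF[of w] DERIV_std_normal_density[of w] \<phi>_pos[of w]
    by (auto intro!: derivative_eq_intros simp: \<phi>_def[symmetric] q_def f_def field_simps)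
  have wf: "\<bar>w\<bar> * \<bar>f w\<bar> \<le> 1" and "\<bar>f w\<bar> \<le> 1 / std_normal_density 1" for w
    using mills_bound[OF F_le(2) F_le(1), of w] \<phi>_pos[of w]
    by (auto simp: f_def \<phi>_def[symmetric] field_simps)
  moreover have "1 / std_normal_density 1 \<le> 5"
    using std_normal_density_1_ge by (simp add: divide_simps)
  ultimately have fb: "\<bar>f w\<bar> \<le> 5" for w by (meson order_trans)
  have "\<bar>f' w\<bar> \<le> 2" for w
    using wf[of w] hc[of w] unfolding f'_def by (simp add: abs_mult[symmetric])
  moreover have "f' w = w * f w + h w - (\<integral>x. h x \<partial>std_normal_distribution)" for w
    by (simp only: f'_def c_def)
  ultimately show ?thesis using df fb by blast
qed

text \<open>A ramp of width \<delta> lies between the indicators of two half-lines whose endpoints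
  differ by \<delta>. The extra \<delta> in the bound is the growth of the normal distribution
  function over such a distance, its density being at most 1.\<close>

lemma smooth_cdf_bound:
  fixes T :: "'w \<Rightarrow> real"
  assumes M: "prob_space M" and T[measurable]: "T \<in> borel_measurable M" and \<delta>: "0 < \<delta>"
    and h: "\<And>h :: real \<Rightarrow> real. continuous_on UNIV h \<Longrightarrow> (\<And>x. 0 \<le> h x) \<Longrightarrow> (\<And>x. h x \<le> 1) \<Longrightarrow>
        (\<And>x y. \<bar>h x - h y\<bar> \<le> \<bar>x - y\<bar> / \<delta>) \<Longrightarrow>
        \<bar>(\<integral>\<omega>. h (T \<omega>) \<partial>M) - (\<integral>x. h x \<partial>std_normal_distribution)\<bar> \<le> \<epsilon>"
  shows "\<bar>measure M {\<omega> \<in> space M. T \<omega> \<le> x} - cdf std_normal_distribution x\<bar> \<le> \<epsilon> + \<delta>"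
proof -
  interpret prob_space M by (rule M)
  \<comment> \<open>Equal to 1 up to y, equal to 0 from y + \<delta> on, linear in between.\<close>
  define H where "H y t = max 0 (min 1 ((y + \<delta> - t) / \<delta>))" for y t :: real
  have H01: "0 \<le> H y t" "H y t \<le> 1" for y t by (auto simp: H_def)
  have H_cont: "continuous_on UNIV (H y)" for y
    unfolding H_def[abs_def] using \<delta> by (intro continuous_intros) auto
  have [measurable]: "H y \<in> borel_measurable borel" for y
    by (rule borel_measurable_continuous_onI[OF H_cont])
  have H_lip: "\<bar>H y s - H y t\<bar> \<le> \<bar>s - t\<bar> / \<delta>" for y s t
  proof -
    have "\<bar>H y s - H y t\<bar> \<le> \<bar>(y + \<delta> - s) / \<delta> - (y + \<delta> - t) / \<delta>\<bar>"
      unfolding H_def by linarith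
    also have "(y + \<delta> - s) / \<delta> - (y + \<delta> - t) / \<delta> = (t - s) / \<delta>"
      by (simp add: diff_divide_distrib)
    finally show ?thesis using \<delta> by (simp add: abs_minus_commute)
  qed
  have H_ge: "indicator {..y} t \<le> H y t" for y t
    using \<delta> by (auto simp: H_def indicator_def min_def max_def field_simps)
  have H_le: "H y t \<le> indicator {..y + \<delta>} t" for y t
    using \<delta> by (auto simp: H_def indicator_def min_def max_def divide_nonpos_pos)
  \<comment> \<open>Stated for a space over a fresh type, because it is applied both to T on M and
    to the identity under the normal law.\<close>
  have bounds: "measure N {\<omega> \<in> space N. S \<omega> \<le> y} \<le> (\<integral>\<omega>. H y (S \<omega>) \<partial>N)"
      "(\<integral>\<omega>. H y (S \<omega>) \<partial>N) \<le> measure N {\<omega> \<in> space N. S \<omega> \<le> y + \<delta>}"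
    if N: "prob_space N" and S[measurable]: "S \<in> borel_measurable N" for N :: "'b measure" and S y
  proof -
    interpret N: prob_space N by (rule N)
    have int: "integrable N (\<lambda>\<omega>. H y (S \<omega>))"
      using H01 by (intro N.integrable_const_bound[where B=1]) auto
    have ind: "measure N {\<omega> \<in> space N. S \<omega> \<le> z} = (\<integral>\<omega>. indicator {..z} (S \<omega>) \<partial>N)"
        "integrable N (\<lambda>\<omega>. indicator {..z} (S \<omega>) :: real)" for z
    proof -
      have "(\<integral>\<omega>. indicat_real {..z} (S \<omega>) \<partial>N) = (\<integral>\<omega>. indicator {\<omega> \<in> space N. S \<omega> \<le> z} \<omega> \<partial>N)"
        by (intro Bochner_Integration.integral_cong) (auto simp: indicator_def)
      then show "measure N {\<omega> \<in> space N. S \<omega> \<le> z} = (\<integral>\<omega>. indicator {..z} (S \<omega>) \<partial>N)"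
        by (simp add: Int_absorb1)
      show "integrable N (\<lambda>\<omega>. indicator {..z} (S \<omega>) :: real)"
        by (intro N.integrable_const_bound[where B=1]) auto
    qed
    show "measure N {\<omega> \<in> space N. S \<omega> \<le> y} \<le> (\<integral>\<omega>. H y (S \<omega>) \<partial>N)"
      unfolding ind(1) by (intro integral_mono ind(2) int H_ge)
    show "(\<integral>\<omega>. H y (S \<omega>) \<partial>N) \<le> measure N {\<omega> \<in> space N. S \<omega> \<le> y + \<delta>}"
      unfolding ind(1) by (intro integral_mono ind(2) int H_le)
  qed
  have cdf_eq: "measure std_normal_distribution {\<omega> \<in> space std_normal_distribution. \<omega> \<le> y}
      = cdf std_normal_distribution y" for y
    by (simp add: cdf_def atMost_def)
  note bN = bounds[OF std_normal.prob_space_axioms, of "\<lambda>x. x", simplified cdf_eq]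
  note bT = bounds[OF M T]
  have cdf_lip: "cdf std_normal_distribution (y + \<delta>) \<le> cdf std_normal_distribution y + \<delta>" for y
  proof -
    have "emeasure std_normal_distribution {y<..y + \<delta>}
        = (\<integral>\<^sup>+t. ennreal (std_normal_density t) * indicator {y<..y + \<delta>} t \<partial>lborel)"
      by (simp add: emeasure_density)
    also have "\<dots> \<le> (\<integral>\<^sup>+t. indicator {y<..y + \<delta>} t \<partial>lborel)"
      using std_normal_density_le_1 by (intro nn_integral_mono) (auto simp: indicator_def)
    also have "\<dots> = ennreal \<delta>" using \<delta> by simp
    finally have "measure std_normal_distribution {y<..y + \<delta>} \<le> \<delta>"
      using \<delta> by (simp add: std_normal.emeasure_eq_measure)
    moreover have "measure std_normal_distribution ({..y} \<union> {y<..y + \<delta>})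
        = measure std_normal_distribution {..y} + measure std_normal_distribution {y<..y + \<delta>}"
      by (intro std_normal.finite_measure_Union) auto
    moreover have "{..y} \<union> {y<..y + \<delta>} = {..y + \<delta>}" using \<delta> by auto
    ultimately show ?thesis by (simp add: cdf_def)
  qed
  have E: "\<bar>(\<integral>\<omega>. H y (T \<omega>) \<partial>M) - (\<integral>x. H y x \<partial>std_normal_distribution)\<bar> \<le> \<epsilon>" for y
    by (rule h[OF H_cont H01 H_lip])
  show ?thesis
    \<comment> \<open>The ramp starting at x gives the upper estimate, the ramp ending at x the
      lower one.\<close>
    using E[of x] E[of "x - \<delta>"] bT(1)[of x] bT(2)[of "x - \<delta>"] bN(1)[of "x - \<delta>"] bN(2)[of x]
      cdf_lip[of x] cdf_lip[of "x - \<delta>"] by simp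
qed

section \<open>Stein's bound for sums of independent bounded variables\<close>

context prob_space begin

lemma integrable_boundedI:
  fixes u :: "'a \<Rightarrow> real"
  assumes "u \<in> borel_measurable M" "\<And>\<omega>. \<omega> \<in> space M \<Longrightarrow> \<bar>u \<omega>\<bar> \<le> B"
  shows "integrable M u"
  using assms by (intro integrable_const_bound[where B=B]) auto

lemma indep_var_sum_others:
  fixes \<xi> :: "'i \<Rightarrow> 'a \<Rightarrow> real"
  assumes "finite I" "indep_vars (\<lambda>_. borel) \<xi> I" "i \<in> I"
  shows "indep_var borel (\<xi> i) borel (\<lambda>\<omega>. \<Sum>j\<in>I - {i}. \<xi> j \<omega>)"
  using assms by (intro indep_vars_sum) (auto simp: insert_absorb)

lemma expectation_mult_indep:
  fixes f g :: "real \<Rightarrow> real"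
  assumes ind: "indep_var borel X borel Y"
    and [measurable]: "f \<in> borel_measurable borel" "g \<in> borel_measurable borel"
    and int: "integrable M (\<lambda>\<omega>. f (X \<omega>))" "integrable M (\<lambda>\<omega>. g (Y \<omega>))"
  shows "expectation (\<lambda>\<omega>. f (X \<omega>) * g (Y \<omega>)) = expectation (\<lambda>\<omega>. f (X \<omega>)) * expectation (\<lambda>\<omega>. g (Y \<omega>))"
    and "integrable M (\<lambda>\<omega>. f (X \<omega>) * g (Y \<omega>))"
proof -
  have "indep_var borel (f \<circ> X) borel (g \<circ> Y)"
    by (rule indep_var_compose[OF ind]) auto
  then have i: "indep_var borel (\<lambda>\<omega>. f (X \<omega>)) borel (\<lambda>\<omega>. g (Y \<omega>))" by (simp add: comp_def)
  show "expectation (\<lambda>\<omega>. f (X \<omega>) * g (Y \<omega>)) = expectation (\<lambda>\<omega>. f (X \<omega>)) * expectation (\<lambda>\<omega>. g (Y \<omega>))"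
    by (rule indep_var_lebesgue_integral[OF i int])
  show "integrable M (\<lambda>\<omega>. f (X \<omega>) * g (Y \<omega>))"
    by (rule indep_var_integrable[OF i int])
qed

text \<open>The square of the sum consists of the squares of the summands and the products of each
  summand with the sum of all others; independence and zero means kill the latter.\<close>

lemma second_moment_sum_indep:
  fixes \<xi> :: "'i \<Rightarrow> 'a \<Rightarrow> real"
  assumes fin: "finite I" and ind: "indep_vars (\<lambda>_. borel) \<xi> I"
    and bd: "\<And>i \<omega>. i \<in> I \<Longrightarrow> \<omega> \<in> space M \<Longrightarrow> \<bar>\<xi> i \<omega>\<bar> \<le> b"
    and mean: "\<And>i. i \<in> I \<Longrightarrow> expectation (\<xi> i) = 0"
  shows "expectation (\<lambda>\<omega>. (\<Sum>i\<in>I. \<xi> i \<omega>)\<^sup>2) = (\<Sum>i\<in>I. expectation (\<lambda>\<omega>. (\<xi> i \<omega>)\<^sup>2))"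
    and "integrable M (\<lambda>\<omega>. (\<Sum>i\<in>I. \<xi> i \<omega>)\<^sup>2)"
proof -
  have m[measurable]: "\<xi> i \<in> borel_measurable M" if "i \<in> I" for i
    using ind that by (auto simp: indep_vars_def)
  have int: "integrable M (\<xi> i)" if "i \<in> I" for i
    using bd[OF that] m[OF that] by (intro integrable_const_bound[where B=b]) auto
  have int2: "integrable M (\<lambda>\<omega>. (\<xi> i \<omega>)\<^sup>2)" if "i \<in> I" for i
  proof (rule integrable_const_bound[where B="b\<^sup>2"])
    show "AE \<omega> in M. norm ((\<xi> i \<omega>)\<^sup>2) \<le> b\<^sup>2"
      using order_trans[OF bd[OF that] abs_ge_self] by (intro AE_I2) (simp add: abs_le_square_iff)
  qed (use m[OF that] in measurable)
  let ?V = "\<lambda>i \<omega>. \<Sum>j\<in>I - {i}. \<xi> j \<omega>"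
  have intV: "integrable M (?V i)" for i by (auto intro!: Bochner_Integration.integrable_sum int)
  have cross: "expectation (\<lambda>\<omega>. \<xi> i \<omega> * ?V i \<omega>) = 0" "integrable M (\<lambda>\<omega>. \<xi> i \<omega> * ?V i \<omega>)" if "i \<in> I" for i
    using expectation_mult_indep[OF indep_var_sum_others[OF fin ind that], of "\<lambda>x. x" "\<lambda>x. x"]
      int[OF that] intV mean[OF that] by auto
  have eq: "(\<Sum>i\<in>I. \<xi> i \<omega>)\<^sup>2 = (\<Sum>i\<in>I. (\<xi> i \<omega>)\<^sup>2 + \<xi> i \<omega> * ?V i \<omega>)" for \<omega>
  proof -
    have "(\<Sum>i\<in>I. \<xi> i \<omega>)\<^sup>2 = (\<Sum>i\<in>I. \<xi> i \<omega> * (\<Sum>j\<in>I. \<xi> j \<omega>))"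
      by (simp add: power2_eq_square sum_distrib_right)
    also have "\<dots> = (\<Sum>i\<in>I. (\<xi> i \<omega>)\<^sup>2 + \<xi> i \<omega> * ?V i \<omega>)"
    proof (rule sum.cong)
      fix i assume "i \<in> I"
      then have "(\<Sum>j\<in>I. \<xi> j \<omega>) = \<xi> i \<omega> + ?V i \<omega>" using fin by (simp add: sum.remove)
      then show "\<xi> i \<omega> * (\<Sum>j\<in>I. \<xi> j \<omega>) = (\<xi> i \<omega>)\<^sup>2 + \<xi> i \<omega> * ?V i \<omega>"
        by (simp only: distrib_left power2_eq_square)
    qed simp
    finally show ?thesis .
  qed
  show "expectation (\<lambda>\<omega>. (\<Sum>i\<in>I. \<xi> i \<omega>)\<^sup>2) = (\<Sum>i\<in>I. expectation (\<lambda>\<omega>. (\<xi> i \<omega>)\<^sup>2))"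
    unfolding eq using int2 cross by (simp del: sum_subtractf)
  show "integrable M (\<lambda>\<omega>. (\<Sum>i\<in>I. \<xi> i \<omega>)\<^sup>2)"
    unfolding eq using int2 cross(2) by (intro Bochner_Integration.integrable_sum Bochner_Integration.integrable_add)
qed

text \<open>By the Stein equation the error is the expectation of f' W - W * f W. Unit total
  variance lets f' W be distributed over the summands with weights E \<xi>_i^2. For each i, both
  resulting terms are compared with E \<xi>_i^2 * E f' (V_i), where the leave-one-out sum V_i is
  independent of \<xi>_i. Each comparison costs b * (L + 7) * E \<xi>_i^2.\<close>

lemma stein_bound:
  fixes \<xi> :: "'i \<Rightarrow> 'a \<Rightarrow> real" and h :: "real \<Rightarrow> real"
  assumes fin: "finite I" and ind: "indep_vars (\<lambda>_. borel) \<xi> I"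
    and bd: "\<And>i \<omega>. i \<in> I \<Longrightarrow> \<omega> \<in> space M \<Longrightarrow> \<bar>\<xi> i \<omega>\<bar> \<le> b"
    and mean: "\<And>i. i \<in> I \<Longrightarrow> expectation (\<xi> i) = 0"
    and var: "(\<Sum>i\<in>I. expectation (\<lambda>\<omega>. (\<xi> i \<omega>)\<^sup>2)) = 1"
    and cont: "continuous_on UNIV h" and h01: "\<And>x. 0 \<le> h x" "\<And>x. h x \<le> 1"
    and lip: "\<And>x y. \<bar>h x - h y\<bar> \<le> L * \<bar>x - y\<bar>"
  shows "\<bar>expectation (\<lambda>\<omega>. h (\<Sum>i\<in>I. \<xi> i \<omega>)) - (\<integral>x. h x \<partial>std_normal_distribution)\<bar> \<le> 2 * b * (L + 7)"
proof -
  obtain f f' where "\<forall>w. (f has_real_derivative f' w) (at w)"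
    "\<forall>w. f' w = w * f w + h w - (\<integral>x. h x \<partial>std_normal_distribution)"
    "\<forall>w. \<bar>f w\<bar> \<le> 5" "\<forall>w. \<bar>f' w\<bar> \<le> 2"
    using stein_solution[OF cont h01] by metis
  then have df: "\<And>w. (f has_real_derivative f' w) (at w)"
    and f': "\<And>w. f' w = w * f w + h w - (\<integral>x. h x \<partial>std_normal_distribution)"
    and fb: "\<And>w. \<bar>f w\<bar> \<le> 5" and f'b: "\<And>w. \<bar>f' w\<bar> \<le> 2" by blast+
  have cont_f: "continuous_on UNIV f"
    by (intro continuous_at_imp_continuous_on ballI DERIV_isCont[OF df])
  have cont_f': "continuous_on UNIV f'"
    unfolding f'[abs_def] by (intro continuous_intros cont cont_f)
  have [measurable]: "f \<in> borel_measurable borel" "f' \<in> borel_measurable borel" "h \<in> borel_measurable borel"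
    by (intro borel_measurable_continuous_onI cont_f cont_f' cont)+
  \<comment> \<open>The mean value theorem in a form that is uniform in the sign of t, since
    summands take both signs.\<close>
  have f_diff: "\<exists>s. \<bar>s\<bar> \<le> \<bar>t\<bar> \<and> f (v + t) - f v = t * f' (v + s)" for v t
  proof (cases t "0::real" rule: linorder_cases)
    case less
    obtain z where z: "v + t < z" "z < v" "f v - f (v + t) = (v - (v + t)) * f' z"
      using MVT2[of "v + t" v f f'] less df by auto
    have "f (v + t) - f v = t * f' (v + (z - v))" using z(3) by (simp add: algebra_simps)
    then show ?thesis using z(1,2) by (intro exI[of _ "z - v"]) auto
  next
    case greater
    obtain z where z: "v < z" "z < v + t" "f (v + t) - f v = (v + t - v) * f' z"
      using MVT2[of v "v + t" f f'] greater df by auto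
    then show ?thesis by (intro exI[of _ "z - v"]) auto
  qed (auto intro!: exI[of _ 0])
  \<comment> \<open>h need not be differentiable, so f has no second derivative; the Stein equation itself
    makes f' locally Lipschitz, with a constant growing linearly in v.\<close>
  have f'_lip: "\<bar>f' (v + t) - f' v\<bar> \<le> \<bar>t\<bar> * (2 * \<bar>v\<bar> + 5 + L)" for v t
  proof -
    obtain s where s: "f (v + t) - f v = t * f' (v + s)" using f_diff by blast
    have "f' (v + t) - f' v = v * (f (v + t) - f v) + t * f (v + t) + (h (v + t) - h v)"
      by (simp add: f' algebra_simps)
    also have "\<dots> = v * (t * f' (v + s)) + t * f (v + t) + (h (v + t) - h v)" by (simp only: s)
    also have "\<bar>\<dots>\<bar> \<le> \<bar>v * (t * f' (v + s))\<bar> + \<bar>t * f (v + t)\<bar> + \<bar>h (v + t) - h v\<bar>" by linarith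
    also have "\<bar>v * (t * f' (v + s))\<bar> \<le> \<bar>v\<bar> * (\<bar>t\<bar> * 2)"
      unfolding abs_mult by (intro mult_left_mono f'b) auto
    also have "\<bar>t * f (v + t)\<bar> \<le> \<bar>t\<bar> * 5"
      unfolding abs_mult by (intro mult_left_mono fb) auto
    also have "\<bar>h (v + t) - h v\<bar> \<le> L * \<bar>t\<bar>" using lip[of "v + t" v] by simp
    finally show ?thesis by (simp add: algebra_simps)
  qed
  have L0: "0 \<le> L" using lip[of 0 1] by simp
  define W where "W \<omega> = (\<Sum>i\<in>I. \<xi> i \<omega>)" for \<omega>
  define V where "V i \<omega> = (\<Sum>j\<in>I - {i}. \<xi> j \<omega>)" for i \<omega>
  have W_eq: "W \<omega> = V i \<omega> + \<xi> i \<omega>" if "i \<in> I" for i \<omega>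
    using that fin by (simp add: W_def V_def sum.remove)
  have m[measurable]: "\<xi> i \<in> borel_measurable M" if "i \<in> I" for i
    using ind that by (auto simp: indep_vars_def)
  have mW[measurable]: "W \<in> borel_measurable M" unfolding W_def[abs_def] by auto
  have mV[measurable]: "V i \<in> borel_measurable M" for i unfolding V_def[abs_def] by auto
  note bdd = integrable_boundedI
  have I0: "I \<noteq> {}" using var by auto
  obtain \<omega>0 where "\<omega>0 \<in> space M" using not_empty by auto
  \<comment> \<open>The sign of b is read off one summand at one sample point; unit variance
    excludes an empty index set.\<close>
  then have b0: "0 \<le> b" using I0 bd by (meson abs_ge_zero all_not_in_conv order_trans)
  \<comment> \<open>A crude bound that serves integrability alone and never enters the
    estimate.\<close>
  have abs_sum: "\<bar>\<Sum>i\<in>J. \<xi> i \<omega>\<bar> \<le> real (card I) * b" if "J \<subseteq> I" "\<omega> \<in> space M" for J \<omega>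
  proof -
    have "\<bar>\<Sum>i\<in>J. \<xi> i \<omega>\<bar> \<le> (\<Sum>i\<in>J. \<bar>\<xi> i \<omega>\<bar>)" by (rule sum_abs)
    also have "\<dots> \<le> real (card J) * b" using that bd by (intro sum_bounded_above) auto
    also have "\<dots> \<le> real (card I) * b" using card_mono[OF fin that(1)] b0 by (intro mult_right_mono) auto
    finally show ?thesis .
  qed
  have int_V: "integrable M (V i)" for i
    using abs_sum[of "I - {i}"] by (intro bdd) (auto simp: V_def)
  have int_\<xi>: "integrable M (\<xi> i)" if "i \<in> I" for i using bd[OF that] m[OF that] by (intro bdd)
  have int_\<xi>2: "integrable M (\<lambda>\<omega>. (\<xi> i \<omega>)\<^sup>2)" if "i \<in> I" for i
    using bd[OF that] m[OF that] by (intro bdd[where B="b\<^sup>2"]) (auto simp: abs_le_square_iff[symmetric] b0)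
  have \<xi>2_nonneg: "0 \<le> expectation (\<lambda>\<omega>. (\<xi> i \<omega>)\<^sup>2)" for i by simp
  \<comment> \<open>From 2 * \<open>\<bar>v\<bar>\<close> <= 1 + v^2, as omitting a summand leaves
    variance at most 1.\<close>
  have EV: "expectation (\<lambda>\<omega>. \<bar>V i \<omega>\<bar>) \<le> 1" for i
  proof -
    have ind': "indep_vars (\<lambda>_. borel) \<xi> (I - {i})" by (rule indep_vars_subset[OF ind]) auto
    have V2: "expectation (\<lambda>\<omega>. (V i \<omega>)\<^sup>2) = (\<Sum>j\<in>I - {i}. expectation (\<lambda>\<omega>. (\<xi> j \<omega>)\<^sup>2))"
        "integrable M (\<lambda>\<omega>. (V i \<omega>)\<^sup>2)"
      unfolding V_def using second_moment_sum_indep[OF _ ind', of b] fin bd mean by auto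
    have "expectation (\<lambda>\<omega>. \<bar>V i \<omega>\<bar>) \<le> expectation (\<lambda>\<omega>. (1 + (V i \<omega>)\<^sup>2) / 2)"
    proof (rule integral_mono)
      show "\<bar>V i \<omega>\<bar> \<le> (1 + (V i \<omega>)\<^sup>2) / 2" for \<omega>
        using zero_le_power2[of "\<bar>V i \<omega>\<bar> - 1"] by (simp add: power2_eq_square algebra_simps)
    qed (use int_V V2 in auto)
    also have "\<dots> = (1 + expectation (\<lambda>\<omega>. (V i \<omega>)\<^sup>2)) / 2" using V2 by (simp add: prob_space)
    also have "expectation (\<lambda>\<omega>. (V i \<omega>)\<^sup>2) \<le> 1"
      unfolding V2 var[symmetric] using fin by (intro sum_mono2) auto
    finally show ?thesis by simp
  qed
  let ?e = "\<lambda>i. expectation (\<lambda>\<omega>. (\<xi> i \<omega>)\<^sup>2)"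
  let ?g = "\<lambda>v. 2 * \<bar>v\<bar> + 5 + L"
  have int_g: "integrable M (\<lambda>\<omega>. ?g (V i \<omega>))" for i using int_V by auto
  \<comment> \<open>Here 7 is 2 * 1 + 5: the bound 2 on f' times the mean absolute value of V_i,
    plus the bound 5 on f.\<close>
  have Eg: "expectation (\<lambda>\<omega>. ?g (V i \<omega>)) \<le> L + 7" for i
  proof -
    have "expectation (\<lambda>\<omega>. ?g (V i \<omega>)) = 2 * expectation (\<lambda>\<omega>. \<bar>V i \<omega>\<bar>) + 5 + L"
      using int_V[of i] by (simp add: prob_space)
    then show ?thesis using EV[of i] by linarith
  qed
  have int_f'W: "integrable M (\<lambda>\<omega>. f' (W \<omega>))" "integrable M (\<lambda>\<omega>. f' (V i \<omega>))" for i
    using f'b by (auto intro!: bdd[where B=2])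
  have int_fV: "integrable M (\<lambda>\<omega>. f (V i \<omega>))" for i
    using fb by (auto intro!: bdd[where B=5])
  have int_\<xi>f: "integrable M (\<lambda>\<omega>. \<xi> i \<omega> * f (W \<omega>))" if "i \<in> I" for i
    using bd[OF that] m[OF that] fb b0
    by (intro bdd[where B="b * 5"]) (auto simp: abs_mult intro!: mult_mono)
  have each: "\<bar>?e i * expectation (\<lambda>\<omega>. f' (W \<omega>)) - expectation (\<lambda>\<omega>. \<xi> i \<omega> * f (W \<omega>))\<bar>
      \<le> ?e i * (2 * b * (L + 7))" if i: "i \<in> I" for i
  proof -
    have indV: "indep_var borel (\<xi> i) borel (V i)"
      unfolding V_def[abs_def] by (rule indep_var_sum_others[OF fin ind i])
    have 1: "\<bar>expectation (\<lambda>\<omega>. f' (W \<omega>)) - expectation (\<lambda>\<omega>. f' (V i \<omega>))\<bar> \<le> b * (L + 7)"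
    proof -
      have "\<bar>expectation (\<lambda>\<omega>. f' (W \<omega>)) - expectation (\<lambda>\<omega>. f' (V i \<omega>))\<bar>
          = \<bar>expectation (\<lambda>\<omega>. f' (W \<omega>) - f' (V i \<omega>))\<bar>"
        using int_f'W by simp
      also have "\<dots> \<le> expectation (\<lambda>\<omega>. \<bar>f' (W \<omega>) - f' (V i \<omega>)\<bar>)" by (rule integral_abs_bound)
      also have "\<dots> \<le> expectation (\<lambda>\<omega>. b * ?g (V i \<omega>))"
      proof (rule integral_mono)
        fix \<omega> assume \<omega>: "\<omega> \<in> space M"
        have "\<bar>f' (W \<omega>) - f' (V i \<omega>)\<bar> \<le> \<bar>\<xi> i \<omega>\<bar> * ?g (V i \<omega>)"
          using f'_lip[of "V i \<omega>" "\<xi> i \<omega>"] by (simp add: W_eq[OF i])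
        also have "\<dots> \<le> b * ?g (V i \<omega>)" using bd[OF i \<omega>] L0 by (intro mult_right_mono) auto
        finally show "\<bar>f' (W \<omega>) - f' (V i \<omega>)\<bar> \<le> b * ?g (V i \<omega>)" .
      qed (use int_f'W int_g in auto)
      also have "\<dots> = b * expectation (\<lambda>\<omega>. ?g (V i \<omega>))" by (rule integral_mult_right_zero)
      also have "\<dots> \<le> b * (L + 7)" using Eg b0 by (intro mult_left_mono)
      finally show ?thesis .
    qed
    \<comment> \<open>This vanishing term is subtracted below, turning \<xi>_i * f W into \<xi>_i
      times an increment of f, that is, \<xi>_i^2 times a value of f' near V_i.\<close>
    have p1: "expectation (\<lambda>\<omega>. \<xi> i \<omega> * f (V i \<omega>)) = 0" "integrable M (\<lambda>\<omega>. \<xi> i \<omega> * f (V i \<omega>))"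
      using expectation_mult_indep[OF indV, of "\<lambda>x. x" f] int_\<xi>[OF i] mean[OF i] int_fV by auto
    have p2: "expectation (\<lambda>\<omega>. (\<xi> i \<omega>)\<^sup>2 * f' (V i \<omega>)) = ?e i * expectation (\<lambda>\<omega>. f' (V i \<omega>))"
        "integrable M (\<lambda>\<omega>. (\<xi> i \<omega>)\<^sup>2 * f' (V i \<omega>))"
      using expectation_mult_indep[OF indV, of "\<lambda>x. x\<^sup>2" f'] int_\<xi>2[OF i] int_f'W by auto
    \<comment> \<open>The Lipschitz factor is taken at V_i rather than at W exactly so that it
      splits off from \<xi>_i^2 here.\<close>
    have p3: "expectation (\<lambda>\<omega>. (\<xi> i \<omega>)\<^sup>2 * ?g (V i \<omega>)) = ?e i * expectation (\<lambda>\<omega>. ?g (V i \<omega>))"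
        "integrable M (\<lambda>\<omega>. (\<xi> i \<omega>)\<^sup>2 * ?g (V i \<omega>))"
      using expectation_mult_indep[OF indV, of "\<lambda>x. x\<^sup>2" ?g] int_\<xi>2[OF i] int_g by auto
    have 2: "\<bar>expectation (\<lambda>\<omega>. \<xi> i \<omega> * f (W \<omega>)) - ?e i * expectation (\<lambda>\<omega>. f' (V i \<omega>))\<bar> \<le> b * (?e i * (L + 7))"
    proof -
      let ?d = "\<lambda>\<omega>. \<xi> i \<omega> * f (W \<omega>) - \<xi> i \<omega> * f (V i \<omega>) - (\<xi> i \<omega>)\<^sup>2 * f' (V i \<omega>)"
      have int_d: "integrable M ?d" using int_\<xi>f[OF i] p1 p2 by auto
      have "\<bar>expectation (\<lambda>\<omega>. \<xi> i \<omega> * f (W \<omega>)) - ?e i * expectation (\<lambda>\<omega>. f' (V i \<omega>))\<bar> = \<bar>expectation ?d\<bar>"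
        using int_\<xi>f[OF i] p1 p2 by simp
      also have "\<dots> \<le> expectation (\<lambda>\<omega>. \<bar>?d \<omega>\<bar>)" by (rule integral_abs_bound)
      also have "\<dots> \<le> expectation (\<lambda>\<omega>. b * ((\<xi> i \<omega>)\<^sup>2 * ?g (V i \<omega>)))"
      proof (rule integral_mono)
        fix \<omega> assume \<omega>: "\<omega> \<in> space M"
        obtain s where s: "\<bar>s\<bar> \<le> \<bar>\<xi> i \<omega>\<bar>" "f (V i \<omega> + \<xi> i \<omega>) - f (V i \<omega>) = \<xi> i \<omega> * f' (V i \<omega> + s)"
          using f_diff by blast
        have "?d \<omega> = \<xi> i \<omega> * (f (V i \<omega> + \<xi> i \<omega>) - f (V i \<omega>)) - (\<xi> i \<omega>)\<^sup>2 * f' (V i \<omega>)"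
          by (simp add: W_eq[OF i] algebra_simps)
        also have "\<dots> = (\<xi> i \<omega>)\<^sup>2 * (f' (V i \<omega> + s) - f' (V i \<omega>))"
          unfolding s(2) by (simp add: power2_eq_square algebra_simps)
        finally have "\<bar>?d \<omega>\<bar> = (\<xi> i \<omega>)\<^sup>2 * \<bar>f' (V i \<omega> + s) - f' (V i \<omega>)\<bar>" by (simp add: abs_mult)
        also have "\<dots> \<le> (\<xi> i \<omega>)\<^sup>2 * (b * ?g (V i \<omega>))"
        proof (intro mult_left_mono)
          have "\<bar>f' (V i \<omega> + s) - f' (V i \<omega>)\<bar> \<le> \<bar>s\<bar> * ?g (V i \<omega>)" by (rule f'_lip)
          also have "\<dots> \<le> b * ?g (V i \<omega>)" using s(1) bd[OF i \<omega>] L0 by (intro mult_right_mono) auto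
          finally show "\<bar>f' (V i \<omega> + s) - f' (V i \<omega>)\<bar> \<le> b * ?g (V i \<omega>)" .
        qed simp
        finally show "\<bar>?d \<omega>\<bar> \<le> b * ((\<xi> i \<omega>)\<^sup>2 * ?g (V i \<omega>))" by (simp only: mult.left_commute)
      qed (use int_d p3 in auto)
      also have "\<dots> = b * (?e i * expectation (\<lambda>\<omega>. ?g (V i \<omega>)))"
        by (simp only: integral_mult_right_zero p3)
      also have "\<dots> \<le> b * (?e i * (L + 7))"
        by (intro mult_left_mono Eg b0 \<xi>2_nonneg)
      finally show ?thesis .
    qed
    have "?e i * \<bar>expectation (\<lambda>\<omega>. f' (W \<omega>)) - expectation (\<lambda>\<omega>. f' (V i \<omega>))\<bar> \<le> ?e i * (b * (L + 7))"
      by (intro mult_left_mono 1 \<xi>2_nonneg)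
    then have "\<bar>?e i * expectation (\<lambda>\<omega>. f' (W \<omega>)) - ?e i * expectation (\<lambda>\<omega>. f' (V i \<omega>))\<bar> \<le> ?e i * (b * (L + 7))"
      by (simp add: abs_mult flip: right_diff_distrib)
    then have "\<bar>?e i * expectation (\<lambda>\<omega>. f' (W \<omega>)) - expectation (\<lambda>\<omega>. \<xi> i \<omega> * f (W \<omega>))\<bar>
      \<le> ?e i * (b * (L + 7)) + b * (?e i * (L + 7))" using 2 by linarith
    also have "\<dots> = ?e i * (2 * b * (L + 7))" by (simp add: algebra_simps)
    finally show ?thesis .
  qed
  let ?N = "\<integral>x. h x \<partial>std_normal_distribution"
  have int_hW: "integrable M (\<lambda>\<omega>. h (W \<omega>))"
    using h01 by (intro bdd[where B=1]) auto
  have Wf: "W \<omega> * f (W \<omega>) = (\<Sum>i\<in>I. \<xi> i \<omega> * f (W \<omega>))" for \<omega>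
    by (subst W_def) (rule sum_distrib_right)
  have "expectation (\<lambda>\<omega>. h (W \<omega>)) - ?N = expectation (\<lambda>\<omega>. h (W \<omega>) - ?N)"
    using int_hW by (simp add: prob_space)
  also have "\<dots> = expectation (\<lambda>\<omega>. f' (W \<omega>) - (\<Sum>i\<in>I. \<xi> i \<omega> * f (W \<omega>)))"
    unfolding Wf[symmetric] by (simp add: f')
  also have "\<dots> = (\<Sum>i\<in>I. ?e i) * expectation (\<lambda>\<omega>. f' (W \<omega>)) - (\<Sum>i\<in>I. expectation (\<lambda>\<omega>. \<xi> i \<omega> * f (W \<omega>)))"
    using int_f'W int_\<xi>f by (simp add: var)
  also have "\<dots> = (\<Sum>i\<in>I. ?e i * expectation (\<lambda>\<omega>. f' (W \<omega>)) - expectation (\<lambda>\<omega>. \<xi> i \<omega> * f (W \<omega>)))"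
    by (simp add: sum_subtractf sum_distrib_right)
  also have "\<bar>\<dots>\<bar> \<le> (\<Sum>i\<in>I. ?e i * (2 * b * (L + 7)))"
    by (intro order_trans[OF sum_abs] sum_mono each)
  also have "\<dots> = 2 * b * (L + 7)" by (simp only: sum_distrib_right[symmetric] var mult_1_left)
  finally show ?thesis by (simp add: W_def)
qed

text \<open>Replacing T by the sum inside a (1/\<delta>)-Lipschitz test function costs r / \<delta>,
  whatever the dependence between the two; the sum is then handled by \<open>stein_bound\<close>
  with L = 1/\<delta>. With an extended integral in the hypothesis, integrability of the difference
  is a consequence instead of a premise.\<close>

lemma kolmogorov_bound_approx_sum:
  fixes \<xi> :: "'i \<Rightarrow> 'a \<Rightarrow> real" and T :: "'a \<Rightarrow> real"
  assumes fin: "finite I" and ind: "indep_vars (\<lambda>_. borel) \<xi> I"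
    and bd: "\<And>i \<omega>. i \<in> I \<Longrightarrow> \<omega> \<in> space M \<Longrightarrow> \<bar>\<xi> i \<omega>\<bar> \<le> b"
    and mean: "\<And>i. i \<in> I \<Longrightarrow> expectation (\<xi> i) = 0"
    and var: "(\<Sum>i\<in>I. expectation (\<lambda>\<omega>. (\<xi> i \<omega>)\<^sup>2)) = 1"
    and T[measurable]: "T \<in> borel_measurable M"
    and r: "(\<integral>\<^sup>+\<omega>. ennreal \<bar>T \<omega> - (\<Sum>i\<in>I. \<xi> i \<omega>)\<bar> \<partial>M) \<le> ennreal r" "0 \<le> r"
    and \<delta>: "0 < \<delta>"
  shows "\<bar>prob {\<omega> \<in> space M. T \<omega> \<le> x} - cdf std_normal_distribution x\<bar>
    \<le> r / \<delta> + 2 * b * (1 / \<delta> + 7) + \<delta>"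
proof (rule smooth_cdf_bound[OF prob_space_axioms T \<delta>])
  fix h :: "real \<Rightarrow> real"
  assume cont: "continuous_on UNIV h" and h01: "\<And>x. 0 \<le> h x" "\<And>x. h x \<le> 1"
    and lip: "\<And>x y. \<bar>h x - h y\<bar> \<le> \<bar>x - y\<bar> / \<delta>"
  have [measurable]: "h \<in> borel_measurable borel" by (rule borel_measurable_continuous_onI[OF cont])
  have m[measurable]: "\<xi> i \<in> borel_measurable M" if "i \<in> I" for i
    using ind that by (auto simp: indep_vars_def)
  define W where "W \<omega> = (\<Sum>i\<in>I. \<xi> i \<omega>)" for \<omega>
  have mW[measurable]: "W \<in> borel_measurable M" unfolding W_def[abs_def] by auto
  have int_TW: "integrable M (\<lambda>\<omega>. \<bar>T \<omega> - W \<omega>\<bar>)"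
    using r(1) by (intro integrableI_bounded) (auto simp: W_def le_less_trans)
  have E_TW: "expectation (\<lambda>\<omega>. \<bar>T \<omega> - W \<omega>\<bar>) \<le> r"
    using r nn_integral_eq_integral[OF int_TW] by (simp add: W_def)
  have int_h: "integrable M (\<lambda>\<omega>. h (T \<omega>))" "integrable M (\<lambda>\<omega>. h (W \<omega>))"
    using h01 by (auto intro!: integrable_const_bound[where B=1])
  have "\<bar>expectation (\<lambda>\<omega>. h (T \<omega>)) - expectation (\<lambda>\<omega>. h (W \<omega>))\<bar> = \<bar>expectation (\<lambda>\<omega>. h (T \<omega>) - h (W \<omega>))\<bar>"
    using int_h by simp
  also have "\<dots> \<le> expectation (\<lambda>\<omega>. \<bar>h (T \<omega>) - h (W \<omega>)\<bar>)" by (rule integral_abs_bound)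
  also have "\<dots> \<le> expectation (\<lambda>\<omega>. \<bar>T \<omega> - W \<omega>\<bar> / \<delta>)"
    by (intro integral_mono lip) (use int_h int_TW in auto)
  also have "\<dots> \<le> r / \<delta>" using E_TW \<delta> by (simp add: divide_right_mono)
  finally have "\<bar>expectation (\<lambda>\<omega>. h (T \<omega>)) - expectation (\<lambda>\<omega>. h (W \<omega>))\<bar> \<le> r / \<delta>" .
  moreover have "\<bar>expectation (\<lambda>\<omega>. h (W \<omega>)) - (\<integral>x. h x \<partial>std_normal_distribution)\<bar> \<le> 2 * b * (1 / \<delta> + 7)"
    unfolding W_def using lip by (intro stein_bound fin ind bd mean var cont h01) (auto)
  ultimately show "\<bar>expectation (\<lambda>\<omega>. h (T \<omega>)) - (\<integral>x. h x \<partial>std_normal_distribution)\<bar> \<le> r / \<delta> + 2 * b * (1 / \<delta> + 7)"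
    by linarith
qed

end

subsection \<open>Empirical frequencies\<close>

text \<open>Above the free scale s, x powr (\<beta> - 1) is at most s powr (\<beta> - 1), which
  produces the quadratic term; below it, x is replaced by s in the power \<beta> or in the whole
  power. The two forms use, besides the second moment, the first moment or no other moment.\<close>

lemma powr_interpolation:
  fixes x s \<beta> :: real
  assumes "0 \<le> x" "0 < s" "0 < \<beta>" "\<beta> \<le> 1"
  shows "x powr (1 + \<beta>) \<le> s powr \<beta> * x + s powr (\<beta> - 1) * x\<^sup>2"
    and "x powr (1 + \<beta>) \<le> s powr (1 + \<beta>) + s powr (\<beta> - 1) * x\<^sup>2"
proof -
  have large: "x powr (1 + \<beta>) \<le> s powr (\<beta> - 1) * x\<^sup>2" if "s \<le> x"
  proof -
    have "x powr (1 + \<beta>) = x powr (\<beta> - 1) * x powr 2" by (simp flip: powr_add)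
    also have "x powr 2 = x\<^sup>2" using assms by (simp add: powr_numeral)
    also have "x powr (\<beta> - 1) * x\<^sup>2 \<le> s powr (\<beta> - 1) * x\<^sup>2"
      using assms that by (intro mult_right_mono powr_mono2') auto
    finally show ?thesis .
  qed
  have nn: "0 \<le> s powr \<beta> * x" "0 \<le> s powr (\<beta> - 1) * x\<^sup>2" "0 \<le> s powr (1 + \<beta>)"
    using assms by auto
  show "x powr (1 + \<beta>) \<le> s powr \<beta> * x + s powr (\<beta> - 1) * x\<^sup>2"
  proof (cases "s \<le> x")
    case False
    have "x powr (1 + \<beta>) = x powr \<beta> * x" using assms by (simp add: powr_add)
    also have "\<dots> \<le> s powr \<beta> * x"
      using assms False by (intro mult_right_mono powr_mono2) auto
    finally show ?thesis using nn by linarith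
  qed (use large nn in linarith)
  show "x powr (1 + \<beta>) \<le> s powr (1 + \<beta>) + s powr (\<beta> - 1) * x\<^sup>2"
  proof (cases "s \<le> x")
    case False
    have "x powr (1 + \<beta>) \<le> s powr (1 + \<beta>)"
      using assms False by (intro powr_mono2) auto
    then show ?thesis using nn by linarith
  qed (use large nn in linarith)
qed

lemma holder_taylor_bound:
  fixes g g' :: "real \<Rightarrow> real"
  assumes deriv: "\<And>x. x \<in> {0..1} \<Longrightarrow> (g has_real_derivative g' x) (at x within {0..1})"
    and holder: "\<And>x y. x \<in> {0..1} \<Longrightarrow> y \<in> {0..1} \<Longrightarrow> \<bar>g' x - g' y\<bar> \<le> K * \<bar>x - y\<bar> powr \<beta>"
    and K: "0 \<le> K" and \<beta>: "0 < \<beta>" and xy: "x \<in> {0..1}" "y \<in> {0..1}"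
  shows "\<bar>g y - g x - g' x * (y - x)\<bar> \<le> K * \<bar>y - x\<bar> powr (1 + \<beta>)"
proof -
  have mvt: "\<exists>z\<in>{u<..<v}. g v - g u = g' z * (v - u)" if "u < v" "u \<in> {0..1}" "v \<in> {0..1}" for u v
    using that by (intro mvt_simple)
      (auto intro!: has_derivative_subset[OF deriv[unfolded has_field_derivative_def]])
  have main: "\<exists>z\<in>{0..1}. \<bar>z - x\<bar> \<le> \<bar>y - x\<bar> \<and> g y - g x = g' z * (y - x)"
  proof (cases x y rule: linorder_cases)
    case less
    then show ?thesis using mvt[of x y] xy by force
  next
    case equal
    then show ?thesis using xy by (intro bexI[of _ x]) auto
  next
    case greater
    then obtain z where z: "z \<in> {y<..<x}" "g x - g y = g' z * (x - y)" using mvt[of y x] xy by auto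
    then have "g y - g x = g' z * (y - x)" by (simp add: algebra_simps)
    then show ?thesis using z(1) xy by (intro bexI[of _ z]) auto
  qed
  then obtain z where z: "z \<in> {0..1}" "\<bar>z - x\<bar> \<le> \<bar>y - x\<bar>" "g y - g x = g' z * (y - x)" by blast
  have "\<bar>g y - g x - g' x * (y - x)\<bar> = \<bar>g' z - g' x\<bar> * \<bar>y - x\<bar>"
    by (simp add: z(3) abs_mult flip: left_diff_distrib)
  also have "\<dots> \<le> (K * \<bar>y - x\<bar> powr \<beta>) * \<bar>y - x\<bar>"
  proof (intro mult_right_mono)
    have "\<bar>g' z - g' x\<bar> \<le> K * \<bar>z - x\<bar> powr \<beta>" using holder z(1) xy by blast
    also have "\<dots> \<le> K * \<bar>y - x\<bar> powr \<beta>"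
      using z(2) K \<beta> by (intro mult_left_mono powr_mono2) auto
    finally show "\<bar>g' z - g' x\<bar> \<le> K * \<bar>y - x\<bar> powr \<beta>" .
  qed simp
  also have "\<dots> = K * \<bar>y - x\<bar> powr (1 + \<beta>)" by (simp add: powr_add)
  finally show ?thesis .
qed

section \<open>Empirical frequencies of a sample from a discrete distribution\<close>

lemma (in prob_space) expectation_discrete_sums:
  fixes J :: "'a \<Rightarrow> nat" and \<psi> :: "nat \<Rightarrow> real"
  assumes J[measurable]: "J \<in> measurable M (count_space UNIV)"
    and p: "\<And>i. prob {\<omega> \<in> space M. J \<omega> = i} = p i"
    and \<psi>: "\<And>i. \<bar>\<psi> i\<bar> \<le> B"
  shows "(\<lambda>i. p i * \<psi> i) sums expectation (\<lambda>\<omega>. \<psi> (J \<omega>))"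
proof -
  have p0: "0 \<le> p i" for i using measure_nonneg p by metis
  \<comment> \<open>Once the law has a density against counting measure, integrability of \<psi>
    under the law is absolute convergence of the series.\<close>
  have D: "distr M (count_space UNIV) J = density (count_space UNIV) (\<lambda>i. ennreal (p i))"
  proof (rule measure_eqI_countable[where A=UNIV])
    fix i
    have "emeasure (distr M (count_space UNIV) J) {i} = emeasure M (J -` {i} \<inter> space M)"
      by (simp add: emeasure_distr)
    also have "J -` {i} \<inter> space M = {\<omega> \<in> space M. J \<omega> = i}" by auto
    also have "emeasure M \<dots> = ennreal (p i)" by (simp add: emeasure_eq_measure p)
    finally show "emeasure (distr M (count_space UNIV) J) {i}
        = emeasure (density (count_space UNIV) (\<lambda>i. ennreal (p i))) {i}"
      by (simp add: emeasure_density nn_integral_count_space_indicator)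
  qed auto
  have "integrable M (\<lambda>\<omega>. \<psi> (J \<omega>))" using \<psi> by (intro integrable_boundedI[where B=B]) auto
  then have "integrable (distr M (count_space UNIV) J) \<psi>" by (simp add: integrable_distr_eq)
  then have "integrable (count_space UNIV) (\<lambda>i. p i * \<psi> i)"
    unfolding D by (subst (asm) integrable_density) (auto simp: p0)
  then have "(\<lambda>i. p i * \<psi> i) sums (\<integral>i. p i * \<psi> i \<partial>count_space UNIV)"
    by (rule sums_integral_count_space_nat)
  also have "(\<integral>i. p i * \<psi> i \<partial>count_space UNIV) = (\<integral>i. \<psi> i \<partial>distr M (count_space UNIV) J)"
    unfolding D by (subst integral_density) (auto simp: p0)
  also have "\<dots> = expectation (\<lambda>\<omega>. \<psi> (J \<omega>))" by (simp add: integral_distr)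
  finally show ?thesis .
qed

text \<open>Observations are recorded as indices of letters, so that the alphabet disappears from
  the probabilistic part; it is reattached through the injective enumeration in the final
  theorem.\<close>

locale discrete_sample = prob_space +
  fixes n :: nat and J :: "nat \<Rightarrow> 'a \<Rightarrow> nat" and p :: "nat \<Rightarrow> real"
  assumes n_pos: "1 \<le> n"
    and J_indep: "indep_vars (\<lambda>_. count_space UNIV) J {1..n}"
    and J_distr: "\<And>k i. k \<in> {1..n} \<Longrightarrow> prob {\<omega> \<in> space M. J k \<omega> = i} = p i"
begin

definition freq :: "nat \<Rightarrow> 'a \<Rightarrow> real" where
  "freq i \<omega> = (\<Sum>k=1..n. indicator {i} (J k \<omega>)) / real n"

lemma J_measurable: "k \<in> {1..n} \<Longrightarrow> J k \<in> measurable M (count_space UNIV)"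
  using J_indep by (auto simp: indep_vars_def)

lemma expectation_sums:
  "(\<And>i. \<bar>\<psi> i\<bar> \<le> B) \<Longrightarrow> k \<in> {1..n} \<Longrightarrow> (\<lambda>i. p i * \<psi> i) sums expectation (\<lambda>\<omega>. \<psi> (J k \<omega>))"
  by (rule expectation_discrete_sums[OF J_measurable J_distr])

lemma integrable_J:
  fixes \<psi> :: "nat \<Rightarrow> real"
  assumes "\<And>i. \<bar>\<psi> i\<bar> \<le> B" "k \<in> {1..n}"
  shows "integrable M (\<lambda>\<omega>. \<psi> (J k \<omega>))"
proof -
  note [measurable] = J_measurable[OF assms(2)]
  show ?thesis by (intro integrable_boundedI[where B=B] assms) simp
qed

lemma p_bounds: "0 \<le> p i" "p i \<le> 1"
  using J_distr[of 1 i] n_pos measure_nonneg[of M "{\<omega> \<in> space M. J 1 \<omega> = i}"]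
    prob_le_1[of "{\<omega> \<in> space M. J 1 \<omega> = i}"] by auto

lemma p_sums_1: "p sums 1"
proof -
  have "(\<lambda>i. p i * 1) sums expectation (\<lambda>\<omega>. 1)"
    by (rule expectation_sums[where B=1 and k=1]) (use n_pos in auto)
  then show ?thesis by (simp add: prob_space)
qed

lemma freq_measurable[measurable]: "freq i \<in> borel_measurable M"
proof -
  have "(\<lambda>\<omega>. indicat_real {i} (J k \<omega>)) \<in> borel_measurable M" if "k \<in> {1..n}" for k
    using measurable_compose[OF J_measurable[OF that], of "indicat_real {i}" borel] by simp
  then show ?thesis unfolding freq_def[abs_def] by auto
qed

lemma freq_bounds: "0 \<le> freq i \<omega>" "freq i \<omega> \<le> 1"
proof -
  have "(\<Sum>k=1..n. indicat_real {i} (J k \<omega>)) \<le> (\<Sum>k=1..n. 1)"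
    by (intro sum_mono) (auto simp: indicator_def)
  then show "freq i \<omega> \<le> 1" using n_pos by (simp add: freq_def divide_le_eq)
  show "0 \<le> freq i \<omega>" by (auto simp: freq_def intro!: divide_nonneg_nonneg sum_nonneg)
qed

lemma freq_eq_0: "i \<notin> (\<lambda>k. J k \<omega>) ` {1..n} \<Longrightarrow> freq i \<omega> = 0"
  by (auto simp: freq_def indicator_def)

text \<open>Each observation contributes to exactly one letter. This turns the linear Taylor term, a
  series over letters, into a sample mean of independent variables.\<close>

lemma freq_linear_sums: "(\<lambda>i. \<psi> i * freq i \<omega>) sums ((\<Sum>k=1..n. \<psi> (J k \<omega>)) / real n)"
proof -
  have "(\<lambda>i. \<psi> i * indicat_real {i} (J k \<omega>)) sums \<psi> (J k \<omega>)" for k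
  proof -
    have "(\<lambda>i. \<psi> i * indicat_real {i} (J k \<omega>)) = (\<lambda>i. if i = J k \<omega> then \<psi> i else 0)"
      by (auto simp: indicator_def fun_eq_iff)
    then show ?thesis using sums_single[of "J k \<omega>" \<psi>] by simp
  qed
  then have "(\<lambda>i. \<Sum>k=1..n. \<psi> i * indicat_real {i} (J k \<omega>)) sums (\<Sum>k=1..n. \<psi> (J k \<omega>))"
    by (intro sums_sum)
  from sums_divide[OF this, of "real n"] show ?thesis
    by (simp add: freq_def sum_distrib_left)
qed

lemma expectation_indicator_J:
  assumes "k \<in> {1..n}" shows "expectation (\<lambda>\<omega>. indicat_real {i} (J k \<omega>)) = p i"
proof -
  have "(\<lambda>j. p j * indicat_real {i} j) sums expectation (\<lambda>\<omega>. indicat_real {i} (J k \<omega>))"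
    by (rule expectation_sums[where B=1]) (use assms in auto)
  moreover have "(\<lambda>j. p j * indicat_real {i} j) = (\<lambda>j. if j = i then p j else 0)"
    by (auto simp: indicator_def)
  ultimately show ?thesis using sums_single[of i p] sums_unique2 by metis
qed

lemma integrable_freq: "integrable M (freq i)"
  using freq_bounds by (intro integrable_boundedI[where B=1]) auto

lemma expectation_freq: "expectation (freq i) = p i"
proof -
  have "expectation (freq i) = (\<Sum>k=1..n. expectation (\<lambda>\<omega>. indicat_real {i} (J k \<omega>))) / real n"
    unfolding freq_def[abs_def] by (auto intro!: Bochner_Integration.integral_sum integrable_J[where B=1])
  also have "\<dots> = p i" using n_pos expectation_indicator_J by simp
  finally show ?thesis .
qed

text \<open>The crude triangle inequality is preferred to the bound sqrt (p i / n) because it is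
  linear in p i and therefore summable over every alphabet.\<close>

lemma expectation_abs_dev: "expectation (\<lambda>\<omega>. \<bar>freq i \<omega> - p i\<bar>) \<le> 2 * p i"
proof -
  have "expectation (\<lambda>\<omega>. \<bar>freq i \<omega> - p i\<bar>) \<le> expectation (\<lambda>\<omega>. freq i \<omega> + p i)"
  proof (rule integral_mono)
    show "\<bar>freq i \<omega> - p i\<bar> \<le> freq i \<omega> + p i" for \<omega>
      using freq_bounds[of i \<omega>] p_bounds[of i] by linarith
  qed (use integrable_freq in auto)
  also have "\<dots> = 2 * p i" using integrable_freq by (simp add: expectation_freq prob_space)
  finally show ?thesis .
qed

text \<open>The factor c is free because the lemma serves twice: with an indicator and c = 1/n for a
  single frequency, and with the derivatives at the true probabilities and c = 1/(sqrt n * \<sigma>)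
  for the linear term.\<close>

lemma standardized_sum:
  fixes \<psi> :: "nat \<Rightarrow> real"
  assumes \<psi>: "\<And>i. \<bar>\<psi> i\<bar> \<le> B"
  defines "\<mu> \<equiv> \<Sum>i. p i * \<psi> i" and "v \<equiv> (\<Sum>i. p i * (\<psi> i)\<^sup>2) - (\<Sum>i. p i * \<psi> i)\<^sup>2"
  shows "indep_vars (\<lambda>_. borel) (\<lambda>k \<omega>. c * (\<psi> (J k \<omega>) - \<mu>)) {1..n}"
    and "\<And>k \<omega>. \<bar>c * (\<psi> (J k \<omega>) - \<mu>)\<bar> \<le> \<bar>c\<bar> * (2 * B)"
    and "\<And>k. k \<in> {1..n} \<Longrightarrow> expectation (\<lambda>\<omega>. c * (\<psi> (J k \<omega>) - \<mu>)) = 0"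
    and "\<And>k. k \<in> {1..n} \<Longrightarrow> expectation (\<lambda>\<omega>. (c * (\<psi> (J k \<omega>) - \<mu>))\<^sup>2) = c\<^sup>2 * v"
proof -
  have \<mu>: "expectation (\<lambda>\<omega>. \<psi> (J k \<omega>)) = \<mu>" if "k \<in> {1..n}" for k
    using sums_unique[OF expectation_sums[OF \<psi> that]] by (simp add: \<mu>_def)
  have B0: "0 \<le> B" using \<psi> abs_ge_zero order_trans by blast
  have \<psi>2: "\<bar>(\<psi> i)\<^sup>2\<bar> \<le> B\<^sup>2" for i
    using \<psi>[of i] B0 by (simp flip: abs_le_square_iff)
  have int: "integrable M (\<lambda>\<omega>. \<psi> (J k \<omega>))" "integrable M (\<lambda>\<omega>. (\<psi> (J k \<omega>))\<^sup>2)" if "k \<in> {1..n}" for k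
    using integrable_J[where \<psi>=\<psi>, OF \<psi> that]
      integrable_J[where \<psi>="\<lambda>i. (\<psi> i)\<^sup>2", OF \<psi>2 that] by auto
  have \<mu>2: "expectation (\<lambda>\<omega>. (\<psi> (J k \<omega>))\<^sup>2) = v + \<mu>\<^sup>2" if "k \<in> {1..n}" for k
    using sums_unique[OF expectation_sums[OF \<psi>2 that]] by (simp add: v_def \<mu>_def)
  show "indep_vars (\<lambda>_. borel) (\<lambda>k \<omega>. c * (\<psi> (J k \<omega>) - \<mu>)) {1..n}"
    by (rule indep_vars_compose2[OF J_indep]) simp
  have "\<bar>\<mu>\<bar> \<le> B"
  proof -
    have 1: "1 \<in> {1..n}" using n_pos by simp
    have "\<bar>\<mu>\<bar> \<le> expectation (\<lambda>\<omega>. \<bar>\<psi> (J 1 \<omega>)\<bar>)"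
      unfolding \<mu>[OF 1, symmetric] by (rule integral_abs_bound)
    also have "\<dots> \<le> B" using \<psi> int(1)[OF 1] by (intro integral_le_const) auto
    finally show ?thesis .
  qed
  then have "\<bar>\<psi> i - \<mu>\<bar> \<le> 2 * B" for i using \<psi>[of i] by linarith
  then show "\<bar>c * (\<psi> (J k \<omega>) - \<mu>)\<bar> \<le> \<bar>c\<bar> * (2 * B)" for k \<omega>
    unfolding abs_mult by (intro mult_left_mono) auto
  show "expectation (\<lambda>\<omega>. c * (\<psi> (J k \<omega>) - \<mu>)) = 0" if "k \<in> {1..n}" for k
    using int[OF that] \<mu>[OF that] by (simp add: prob_space)
  show "expectation (\<lambda>\<omega>. (c * (\<psi> (J k \<omega>) - \<mu>))\<^sup>2) = c\<^sup>2 * v" if "k \<in> {1..n}" for k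
  proof -
    have "(\<lambda>\<omega>. (c * (\<psi> (J k \<omega>) - \<mu>))\<^sup>2) = (\<lambda>\<omega>. c\<^sup>2 * ((\<psi> (J k \<omega>))\<^sup>2 - 2 * \<mu> * \<psi> (J k \<omega>) + \<mu>\<^sup>2))"
      by (auto simp: power2_eq_square algebra_simps)
    then show ?thesis
      using int[OF that] \<mu>[OF that] \<mu>2[OF that] by (simp add: prob_space power2_eq_square)
  qed
qed

text \<open>The deviation is a standardized sum for the indicator of i with c = 1/n; an indicator
  equals its square, so the exact value is (p i - (p i)^2) / n.\<close>

lemma second_moment_dev:
  "expectation (\<lambda>\<omega>. (freq i \<omega> - p i)\<^sup>2) \<le> p i / real n"
  "integrable M (\<lambda>\<omega>. (freq i \<omega> - p i)\<^sup>2)"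
proof -
  have \<mu>: "(\<Sum>j. p j * indicat_real {i} j) = p i" "(\<Sum>j. p j * (indicat_real {i} j)\<^sup>2) = p i"
    using sums_unique[OF sums_single[of i p]]
    by (auto simp: indicator_def of_bool_def if_distrib if_distribR cong: if_cong)
  have ind_le: "\<bar>indicat_real {i} j\<bar> \<le> 1" for j by (simp add: indicator_def)
  note S = standardized_sum[where \<psi>="indicat_real {i}" and c="1 / real n", OF ind_le, unfolded \<mu>]
  have eq: "freq i \<omega> - p i = (\<Sum>k=1..n. 1 / real n * (indicat_real {i} (J k \<omega>) - p i))" for \<omega>
    using n_pos by (simp add: freq_def sum_subtractf sum_divide_distrib[symmetric] diff_divide_distrib)
  have "expectation (\<lambda>\<omega>. (freq i \<omega> - p i)\<^sup>2)
      = (\<Sum>k=1..n. expectation (\<lambda>\<omega>. (1 / real n * (indicat_real {i} (J k \<omega>) - p i))\<^sup>2))"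
    unfolding eq by (rule second_moment_sum_indep(1)[OF _ S(1) S(2) S(3)]) auto
  also have "\<dots> = (\<Sum>k=1..n. (1 / real n)\<^sup>2 * (p i - (p i)\<^sup>2))"
    by (rule sum.cong[OF refl S(4)])
  also have "\<dots> = (p i - (p i)\<^sup>2) / real n" using n_pos by (simp add: power2_eq_square)
  also have "\<dots> \<le> p i / real n" by (intro divide_right_mono) auto
  finally show "expectation (\<lambda>\<omega>. (freq i \<omega> - p i)\<^sup>2) \<le> p i / real n" .
  show "integrable M (\<lambda>\<omega>. (freq i \<omega> - p i)\<^sup>2)"
    unfolding eq by (rule second_moment_sum_indep(2)[OF _ S(1) S(2) S(3)]) auto
qed

text \<open>Meant for \<beta> > 1/2. The bound is linear in p i at the price of the weaker power
  n^(-\<beta>).\<close>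

lemma nn_moment_dev_large:
  assumes \<beta>: "0 < \<beta>" "\<beta> \<le> 1"
  shows "(\<integral>\<^sup>+\<omega>. ennreal (\<bar>freq i \<omega> - p i\<bar> powr (1 + \<beta>)) \<partial>M) \<le> ennreal (3 * real n powr - \<beta> * p i)"
proof -
  \<comment> \<open>At this scale s powr (\<beta> - 1) / n equals s powr \<beta>, so first and
    second moment contribute 2 and 1 to the constant 3.\<close>
  define s where "s = 1 / real n"
  have s: "0 < s" using n_pos by (simp add: s_def)
  have int: "integrable M (\<lambda>\<omega>. \<bar>freq i \<omega> - p i\<bar>)" using integrable_freq by auto
  let ?u = "\<lambda>\<omega>. s powr \<beta> * \<bar>freq i \<omega> - p i\<bar> + s powr (\<beta> - 1) * (freq i \<omega> - p i)\<^sup>2"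
  have "(\<integral>\<^sup>+\<omega>. ennreal (\<bar>freq i \<omega> - p i\<bar> powr (1 + \<beta>)) \<partial>M) \<le> (\<integral>\<^sup>+\<omega>. ennreal (?u \<omega>) \<partial>M)"
    using powr_interpolation(1)[OF abs_ge_zero s \<beta>] by (intro nn_integral_mono ennreal_leI) simp
  also have "\<dots> = ennreal (expectation ?u)"
    using int second_moment_dev(2) by (intro nn_integral_eq_integral) auto
  also have "\<dots> \<le> ennreal (3 * real n powr - \<beta> * p i)"
  proof (rule ennreal_leI)
    have "expectation ?u = s powr \<beta> * expectation (\<lambda>\<omega>. \<bar>freq i \<omega> - p i\<bar>)
        + s powr (\<beta> - 1) * expectation (\<lambda>\<omega>. (freq i \<omega> - p i)\<^sup>2)"
      using int second_moment_dev(2) by simp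
    also have "\<dots> \<le> s powr \<beta> * (2 * p i) + s powr (\<beta> - 1) * (p i / real n)"
      by (intro add_mono mult_left_mono expectation_abs_dev second_moment_dev) auto
    also have "s powr (\<beta> - 1) * (p i / real n) = s powr \<beta> * p i"
      using s by (simp add: powr_diff s_def)
    also have "s powr \<beta> * (2 * p i) + s powr \<beta> * p i = 3 * s powr \<beta> * p i" by simp
    finally show "expectation ?u \<le> 3 * real n powr - \<beta> * p i"
      using n_pos by (simp add: s_def powr_divide powr_minus_divide)
  qed
  finally show ?thesis .
qed

text \<open>Meant for \<beta> <= 1/2. Interpolation takes place at the scale of the standard
  deviation, where both terms equal s powr (1 + \<beta>).\<close>

lemma nn_moment_dev_small:
  assumes \<beta>: "0 < \<beta>" "\<beta> \<le> 1"
  shows "(\<integral>\<^sup>+\<omega>. ennreal (\<bar>freq i \<omega> - p i\<bar> powr (1 + \<beta>)) \<partial>M)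
    \<le> ennreal (2 * real n powr - ((1 + \<beta>) / 2) * p i powr ((1 + \<beta>) / 2))"
\<comment> \<open>The scale sqrt (p i / n) degenerates for a letter of probability zero; there the
  bound linear in p i already gives moment zero.\<close>
proof (cases "p i = 0")
  case True
  then show ?thesis using nn_moment_dev_large[OF \<beta>, of i] by simp
next
  case False
  define s where "s = sqrt (p i / real n)"
  have p: "0 < p i" using False p_bounds(1)[of i] by linarith
  have s: "0 < s" and s2: "s\<^sup>2 = p i / real n" using n_pos p by (auto simp: s_def)
  let ?u = "\<lambda>\<omega>. s powr (1 + \<beta>) + s powr (\<beta> - 1) * (freq i \<omega> - p i)\<^sup>2"
  have "(\<integral>\<^sup>+\<omega>. ennreal (\<bar>freq i \<omega> - p i\<bar> powr (1 + \<beta>)) \<partial>M) \<le> (\<integral>\<^sup>+\<omega>. ennreal (?u \<omega>) \<partial>M)"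
    using powr_interpolation(2)[OF abs_ge_zero s \<beta>] by (intro nn_integral_mono ennreal_leI) simp
  also have "\<dots> = ennreal (expectation ?u)"
    using second_moment_dev(2) by (intro nn_integral_eq_integral) auto
  also have "\<dots> \<le> ennreal (2 * real n powr - ((1 + \<beta>) / 2) * p i powr ((1 + \<beta>) / 2))"
  proof (rule ennreal_leI)
    have "expectation ?u = s powr (1 + \<beta>) + s powr (\<beta> - 1) * expectation (\<lambda>\<omega>. (freq i \<omega> - p i)\<^sup>2)"
      using second_moment_dev(2) by (simp add: prob_space)
    also have "\<dots> \<le> s powr (1 + \<beta>) + s powr (\<beta> - 1) * s powr 2"
      using second_moment_dev(1)[of i] s by (intro add_mono mult_left_mono) (auto simp: powr_numeral s2)
    also have "\<dots> = 2 * s powr (1 + \<beta>)" by (simp flip: powr_add)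
    finally have "expectation ?u \<le> 2 * s powr (1 + \<beta>)" .
    moreover have "s powr (1 + \<beta>) = (p i / real n) powr ((1 + \<beta>) / 2)"
      using p n_pos by (simp add: s_def powr_half_sqrt[symmetric] powr_powr)
    moreover have "\<dots> = real n powr - ((1 + \<beta>) / 2) * p i powr ((1 + \<beta>) / 2)"
      using p n_pos by (simp add: powr_divide powr_minus_divide)
    ultimately show "expectation ?u \<le> 2 * real n powr - ((1 + \<beta>) / 2) * p i powr ((1 + \<beta>) / 2)" by simp
  qed
  finally show ?thesis .
qed

text \<open>Linearising g at each p i gives independent summands bounded by 2 * B / (sqrt n *
  \<sigma>). Summed over the letters, the Taylor remainders have mean absolute value at most K * m.
  The total moment m is kept abstract so that both regimes of \<beta> can use the result.\<close>

lemma kolmogorov_bound_plug_in: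
  fixes g g' :: "real \<Rightarrow> real"
  assumes deriv: "\<And>x. x \<in> {0..1} \<Longrightarrow> (g has_real_derivative g' x) (at x within {0..1})"
    and holder: "\<And>x y. x \<in> {0..1} \<Longrightarrow> y \<in> {0..1} \<Longrightarrow> \<bar>g' x - g' y\<bar> \<le> K * \<bar>x - y\<bar> powr \<beta>"
    and K: "0 \<le> K" and \<beta>: "0 < \<beta>"
    and B: "\<And>x. x \<in> {0..1} \<Longrightarrow> \<bar>g' x\<bar> \<le> B"
    and sum_g: "summable (\<lambda>i. \<bar>g (p i)\<bar>)"
    and moment: "(\<Sum>i. \<integral>\<^sup>+\<omega>. ennreal (\<bar>freq i \<omega> - p i\<bar> powr (1 + \<beta>)) \<partial>M) \<le> ennreal m" "0 \<le> m"
    and \<sigma>: "0 < asymp_sd g' p" and \<delta>: "0 < \<delta>"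
  defines "\<sigma> \<equiv> asymp_sd g' p"
  shows "\<bar>prob {\<omega> \<in> space M. sqrt (real n) / \<sigma> * ((\<Sum>i. g (freq i \<omega>)) - (\<Sum>i. g (p i))) \<le> x}
      - cdf std_normal_distribution x\<bar>
    \<le> sqrt (real n) / \<sigma> * K * m / \<delta> + 2 * (2 * B / (sqrt (real n) * \<sigma>)) * (1 / \<delta> + 7) + \<delta>"
proof -
  define \<psi> where "\<psi> i = g' (p i)" for i
  \<comment> \<open>Chosen so that n * c^2 * \<sigma>^2 = 1.\<close>
  define c where "c = 1 / (sqrt (real n) * \<sigma>)"
  define v where "v = (\<Sum>i. p i * (\<psi> i)\<^sup>2) - (\<Sum>i. p i * \<psi> i)\<^sup>2"
  define \<mu> where "\<mu> = (\<Sum>i. p i * \<psi> i)"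
  define R where "R i \<omega> = g (freq i \<omega>) - g (p i) - g' (p i) * (freq i \<omega> - p i)" for i \<omega>
  have p01: "p i \<in> {0..1}" for i using p_bounds[of i] by simp
  have f01: "freq i \<omega> \<in> {0..1}" for i \<omega> using freq_bounds[of i \<omega>] by simp
  have \<sigma>0: "0 < \<sigma>" using \<sigma> by (simp add: \<sigma>_def)
  \<comment> \<open>\<open>sqrt\<close> is total and odd, so undoing it needs 0 <= v; this follows
    from 0 < sqrt v.\<close>
  have \<sigma>2: "\<sigma>\<^sup>2 = v"
  proof -
    have "\<sigma> = sqrt v" by (simp add: \<sigma>_def asymp_sd_def v_def \<psi>_def)
    then show ?thesis using \<sigma>0 by (simp add: real_sqrt_gt_0_iff)
  qed
  have n0: "0 < real n" using n_pos by simp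
  have c0: "0 < c" using \<sigma>0 n0 by (simp add: c_def)
  have \<psi>B: "\<bar>\<psi> i\<bar> \<le> B" for i using B[OF p01] by (simp add: \<psi>_def)
  note S = standardized_sum[where \<psi>=\<psi> and c=c, OF \<psi>B, folded \<mu>_def v_def]
  have \<mu>_sums: "(\<lambda>i. p i * \<psi> i) sums \<mu>"
  proof -
    have "summable (\<lambda>i. p i * \<psi> i)"
      by (rule sums_summable[OF expectation_sums[of \<psi>, OF \<psi>B, of 1]]) (use n_pos in simp)
    then show ?thesis unfolding \<mu>_def by (rule summable_sums)
  qed
  have cont_g: "continuous_on {0..1} g" by (rule DERIV_continuous_on[OF deriv])
  \<comment> \<open>Outside the unit interval nothing is known about g, so measurability of g (freq
    i) passes through the restricted Borel space.\<close>
  have "freq i \<in> measurable M (restrict_space borel {0..1})" for i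
    using f01 by (intro measurable_restrict_space2) auto
  from measurable_compose[OF this borel_measurable_continuous_on_restrict[OF cont_g]]
  have [measurable]: "(\<lambda>\<omega>. g (freq i \<omega>)) \<in> borel_measurable M" for i .
  have [measurable]: "R i \<in> borel_measurable M" for i unfolding R_def[abs_def] by measurable
  \<comment> \<open>Needed for convergence of the plug-in series: letters that do not occur in the
    sample then contribute nothing, leaving finitely many terms.\<close>
  have g0: "g 0 = 0"
  proof -
    have "p \<longlonglongrightarrow> 0" by (rule summable_LIMSEQ_zero[OF sums_summable[OF p_sums_1]])
    then have "(\<lambda>i. g (p i)) \<longlonglongrightarrow> g 0"
      by (rule continuous_on_tendsto_compose[OF cont_g]) (use p01 in auto)
    moreover have "(\<lambda>i. g (p i)) \<longlonglongrightarrow> 0"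
      by (rule summable_LIMSEQ_zero[OF summable_rabs_cancel[OF sum_g]])
    ultimately show ?thesis by (rule LIMSEQ_unique)
  qed
  let ?\<theta> = "\<Sum>i. g (p i)"
  let ?T = "\<lambda>\<omega>. sqrt (real n) / \<sigma> * ((\<Sum>i. g (freq i \<omega>)) - ?\<theta>)"
  let ?\<xi> = "\<lambda>k \<omega>. c * (\<psi> (J k \<omega>) - \<mu>)"
  have R_sums: "(\<lambda>i. R i \<omega>) sums ((\<Sum>i. g (freq i \<omega>)) - ?\<theta> - ((\<Sum>k=1..n. \<psi> (J k \<omega>)) / real n - \<mu>))" for \<omega>
  proof -
    have 1: "(\<lambda>i. g (freq i \<omega>)) sums (\<Sum>i. g (freq i \<omega>))"
      by (intro summable_sums summable_finite[of "(\<lambda>k. J k \<omega>) ` {1..n}"]) (auto simp: freq_eq_0 g0)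
    have 2: "(\<lambda>i. g (p i)) sums ?\<theta>"
      by (rule summable_sums[OF summable_rabs_cancel[OF sum_g]])
    have 3: "(\<lambda>i. \<psi> i * freq i \<omega> - p i * \<psi> i) sums ((\<Sum>k=1..n. \<psi> (J k \<omega>)) / real n - \<mu>)"
      by (intro sums_diff freq_linear_sums \<mu>_sums)
    have "(\<lambda>i. g (freq i \<omega>) - g (p i) - (\<psi> i * freq i \<omega> - p i * \<psi> i)) sums
        ((\<Sum>i. g (freq i \<omega>)) - ?\<theta> - ((\<Sum>k=1..n. \<psi> (J k \<omega>)) / real n - \<mu>))"
      by (rule sums_diff[OF sums_diff[OF 1 2] 3])
    then show ?thesis by (simp add: R_def \<psi>_def algebra_simps)
  qed
  have T_diff: "?T \<omega> - (\<Sum>k=1..n. ?\<xi> k \<omega>) = sqrt (real n) / \<sigma> * (\<Sum>i. R i \<omega>)" for \<omega>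
  proof -
    have c: "c = sqrt (real n) / \<sigma> * (1 / real n)"
      using n0 \<sigma>0 by (simp add: c_def field_simps)
    have "(\<Sum>k=1..n. ?\<xi> k \<omega>) = c * ((\<Sum>k=1..n. \<psi> (J k \<omega>)) - real n * \<mu>)"
      by (simp add: sum_subtractf flip: sum_distrib_left)
    also have "\<dots> = sqrt (real n) / \<sigma> * ((\<Sum>k=1..n. \<psi> (J k \<omega>)) / real n - \<mu>)"
      unfolding c using n0 \<sigma>0 by (simp add: field_simps)
    finally show ?thesis
      unfolding sums_unique[OF R_sums, symmetric] by (simp only: right_diff_distrib)
  qed
  have R_bound: "\<bar>R i \<omega>\<bar> \<le> K * \<bar>freq i \<omega> - p i\<bar> powr (1 + \<beta>)" for i \<omega>
    unfolding R_def by (rule holder_taylor_bound[OF deriv holder K \<beta> p01 f01])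
  \<comment> \<open>Absolute convergence at the individual \<omega> is not established, so the
    triangle inequality is passed to the limit with a right-hand side that may be infinite.\<close>
  have R_abs: "ennreal \<bar>\<Sum>i. R i \<omega>\<bar> \<le> (\<Sum>i. ennreal \<bar>R i \<omega>\<bar>)" for \<omega>
  proof (rule LIMSEQ_le_const2)
    show "(\<lambda>N. ennreal \<bar>\<Sum>i<N. R i \<omega>\<bar>) \<longlonglongrightarrow> ennreal \<bar>\<Sum>i. R i \<omega>\<bar>"
      using sums_summable[OF R_sums] by (intro tendsto_ennrealI tendsto_rabs summable_LIMSEQ)
    have "ennreal \<bar>\<Sum>i<N. R i \<omega>\<bar> \<le> (\<Sum>i. ennreal \<bar>R i \<omega>\<bar>)" for N
    proof -
      have "ennreal \<bar>\<Sum>i<N. R i \<omega>\<bar> \<le> ennreal (\<Sum>i<N. \<bar>R i \<omega>\<bar>)" by (intro ennreal_leI sum_abs)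
      also have "\<dots> = (\<Sum>i<N. ennreal \<bar>R i \<omega>\<bar>)" by simp
      also have "\<dots> \<le> (\<Sum>i. ennreal \<bar>R i \<omega>\<bar>)" by (intro sum_le_suminf) auto
      finally show ?thesis .
    qed
    then show "\<exists>N0. \<forall>N\<ge>N0. ennreal \<bar>\<Sum>i<N. R i \<omega>\<bar> \<le> (\<Sum>i. ennreal \<bar>R i \<omega>\<bar>)" by blast
  qed
  have ennreal_mult_K_m: "ennreal (t * K * m) = ennreal t * ennreal K * ennreal m" if "0 \<le> t" for t
    using that K moment(2) by (simp add: ennreal_mult)
  have remainder: "(\<integral>\<^sup>+\<omega>. ennreal \<bar>?T \<omega> - (\<Sum>k=1..n. ?\<xi> k \<omega>)\<bar> \<partial>M) \<le> ennreal (sqrt (real n) / \<sigma> * K * m)"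
  proof -
    have "(\<integral>\<^sup>+\<omega>. ennreal \<bar>?T \<omega> - (\<Sum>k=1..n. ?\<xi> k \<omega>)\<bar> \<partial>M)
        \<le> (\<integral>\<^sup>+\<omega>. ennreal (sqrt (real n) / \<sigma>) * (\<Sum>i. ennreal \<bar>R i \<omega>\<bar>) \<partial>M)"
    proof (rule nn_integral_mono)
      fix \<omega>
      have "ennreal \<bar>?T \<omega> - (\<Sum>k=1..n. ?\<xi> k \<omega>)\<bar> = ennreal (sqrt (real n) / \<sigma> * \<bar>\<Sum>i. R i \<omega>\<bar>)"
        unfolding T_diff abs_mult using \<sigma>0 by simp
      also have "\<dots> = ennreal (sqrt (real n) / \<sigma>) * ennreal \<bar>\<Sum>i. R i \<omega>\<bar>"
        using \<sigma>0 by (intro ennreal_mult) auto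
      also have "\<dots> \<le> ennreal (sqrt (real n) / \<sigma>) * (\<Sum>i. ennreal \<bar>R i \<omega>\<bar>)"
        by (intro mult_left_mono R_abs) simp
      finally show "ennreal \<bar>?T \<omega> - (\<Sum>k=1..n. ?\<xi> k \<omega>)\<bar>
          \<le> ennreal (sqrt (real n) / \<sigma>) * (\<Sum>i. ennreal \<bar>R i \<omega>\<bar>)" .
    qed
    \<comment> \<open>Monotone convergence exchanges the expectation with the sum over all
      letters.\<close>
    also have "\<dots> = ennreal (sqrt (real n) / \<sigma>) * (\<Sum>i. \<integral>\<^sup>+\<omega>. ennreal \<bar>R i \<omega>\<bar> \<partial>M)"
      by (simp add: nn_integral_cmult nn_integral_suminf)
    also have "(\<Sum>i. \<integral>\<^sup>+\<omega>. ennreal \<bar>R i \<omega>\<bar> \<partial>M)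
        \<le> (\<Sum>i. ennreal K * (\<integral>\<^sup>+\<omega>. ennreal (\<bar>freq i \<omega> - p i\<bar> powr (1 + \<beta>)) \<partial>M))"
    proof (intro suminf_le summableI)
      fix i
      have "(\<integral>\<^sup>+\<omega>. ennreal \<bar>R i \<omega>\<bar> \<partial>M)
          \<le> (\<integral>\<^sup>+\<omega>. ennreal K * ennreal (\<bar>freq i \<omega> - p i\<bar> powr (1 + \<beta>)) \<partial>M)"
        using R_bound K by (intro nn_integral_mono) (simp flip: ennreal_mult)
      then show "(\<integral>\<^sup>+\<omega>. ennreal \<bar>R i \<omega>\<bar> \<partial>M)
          \<le> ennreal K * (\<integral>\<^sup>+\<omega>. ennreal (\<bar>freq i \<omega> - p i\<bar> powr (1 + \<beta>)) \<partial>M)"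
        by (simp add: nn_integral_cmult)
    qed
    also have "\<dots> = ennreal K * (\<Sum>i. \<integral>\<^sup>+\<omega>. ennreal (\<bar>freq i \<omega> - p i\<bar> powr (1 + \<beta>)) \<partial>M)"
      by (rule ennreal_suminf_cmult)
    also have "\<dots> \<le> ennreal K * ennreal m" by (intro mult_left_mono moment) auto
    also have "ennreal (sqrt (real n) / \<sigma>) * (ennreal K * ennreal m) = ennreal (sqrt (real n) / \<sigma> * K * m)"
      using ennreal_mult_K_m[of "sqrt (real n) / \<sigma>"] \<sigma>0 by (simp only: mult.assoc) simp
    finally show ?thesis by (simp add: mult_left_mono)
  qed
  have unit_variance: "(\<Sum>k=1..n. expectation (\<lambda>\<omega>. (?\<xi> k \<omega>)\<^sup>2)) = 1"
  proof -
    have "(\<Sum>k=1..n. expectation (\<lambda>\<omega>. (?\<xi> k \<omega>)\<^sup>2)) = (\<Sum>k=1..n. c\<^sup>2 * v)"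
      by (rule sum.cong[OF refl S(4)])
    then show ?thesis
      using n0 \<sigma>0 by (simp add: c_def \<sigma>2[symmetric] power_mult_distrib power_divide)
  qed
  have "\<bar>prob {\<omega> \<in> space M. ?T \<omega> \<le> x} - cdf std_normal_distribution x\<bar>
      \<le> sqrt (real n) / \<sigma> * K * m / \<delta> + 2 * (\<bar>c\<bar> * (2 * B)) * (1 / \<delta> + 7) + \<delta>"
    using \<sigma>0 K moment(2)
    by (intro kolmogorov_bound_approx_sum[OF _ S(1) S(2) S(3) unit_variance _ remainder _ \<delta>]) auto
  also have "\<bar>c\<bar> * (2 * B) = 2 * B / (sqrt (real n) * \<sigma>)"
    using c0 by (simp add: c_def)
  finally show ?thesis .
qed

end

section \<open>Summing over the letters and choosing the smoothing width\<close>

context discrete_sample begin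

text \<open>The bound linear in p i sums by total mass 1. Here the exponent \<beta> is \<gamma> +
  1/2 exactly in the regime \<beta> > 1/2.\<close>

lemma moment_sum_large:
  assumes \<beta>: "0 < \<beta>" "\<beta> \<le> 1"
  shows "(\<Sum>i. \<integral>\<^sup>+\<omega>. ennreal (\<bar>freq i \<omega> - p i\<bar> powr (1 + \<beta>)) \<partial>M) \<le> ennreal (3 * real n powr - \<beta>)"
proof -
  have "(\<Sum>i. \<integral>\<^sup>+\<omega>. ennreal (\<bar>freq i \<omega> - p i\<bar> powr (1 + \<beta>)) \<partial>M)
      \<le> (\<Sum>i. ennreal (3 * real n powr - \<beta> * p i))"
    by (intro suminf_le summableI nn_moment_dev_large \<beta>)
  also have "\<dots> = ennreal (3 * real n powr - \<beta> * 1)"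
    using p_bounds by (intro suminf_ennreal_eq sums_mult p_sums_1) auto
  finally show ?thesis by simp
qed

text \<open>The power sum enters as an extended real, matching the supremum hypothesis of the
  theorem. Here the exponent (1 + \<beta>) / 2 is \<gamma> + 1/2 in the regime \<beta> <=
  1/2.\<close>

lemma moment_sum_small:
  assumes \<beta>: "0 < \<beta>" "\<beta> \<le> 1"
    and Q: "(\<Sum>i. ennreal (p i powr ((\<beta> + 1) / 2))) \<le> ennreal Q" "0 \<le> Q"
  shows "(\<Sum>i. \<integral>\<^sup>+\<omega>. ennreal (\<bar>freq i \<omega> - p i\<bar> powr (1 + \<beta>)) \<partial>M)
    \<le> ennreal (2 * Q * real n powr - ((1 + \<beta>) / 2))"
proof -
  let ?c = "2 * real n powr - ((1 + \<beta>) / 2)"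
  have "(\<Sum>i. \<integral>\<^sup>+\<omega>. ennreal (\<bar>freq i \<omega> - p i\<bar> powr (1 + \<beta>)) \<partial>M)
      \<le> (\<Sum>i. ennreal ?c * ennreal (p i powr ((\<beta> + 1) / 2)))"
    using nn_moment_dev_small[OF \<beta>]
    by (intro suminf_le summableI) (simp add: add.commute flip: ennreal_mult)
  also have "\<dots> = ennreal ?c * (\<Sum>i. ennreal (p i powr ((\<beta> + 1) / 2)))"
    by (rule ennreal_suminf_cmult)
  also have "\<dots> \<le> ennreal ?c * ennreal Q" by (intro mult_left_mono Q) auto
  also have "\<dots> = ennreal (2 * Q * real n powr - ((1 + \<beta>) / 2))"
    using Q by (simp add: mult_ac flip: ennreal_mult)
  finally show ?thesis .
qed

text \<open>The exponent \<gamma> + 1/2 in the moment hypothesis is the common form of both regimes: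
  the normalising factor sqrt n removes the 1/2. The claimed bound is a multiple of \<delta>
  itself.\<close>

lemma kolmogorov_rate_plug_in:
  fixes g g' :: "real \<Rightarrow> real"
  assumes deriv: "\<And>x. x \<in> {0..1} \<Longrightarrow> (g has_real_derivative g' x) (at x within {0..1})"
    and holder: "\<And>x y. x \<in> {0..1} \<Longrightarrow> y \<in> {0..1} \<Longrightarrow> \<bar>g' x - g' y\<bar> \<le> K * \<bar>x - y\<bar> powr \<beta>"
    and K: "0 \<le> K" and \<beta>: "0 < \<beta>"
    and B: "\<And>x. x \<in> {0..1} \<Longrightarrow> \<bar>g' x\<bar> \<le> B"
    and sum_g: "summable (\<lambda>i. \<bar>g (p i)\<bar>)"
    and A: "(\<Sum>i. \<integral>\<^sup>+\<omega>. ennreal (\<bar>freq i \<omega> - p i\<bar> powr (1 + \<beta>)) \<partial>M)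
      \<le> ennreal (A * real n powr - (\<gamma> + 1/2))" "0 \<le> A"
    and \<gamma>: "\<gamma> \<le> 1/2"
    and \<sigma>: "0 < asymp_sd g' p"
  defines "\<sigma> \<equiv> asymp_sd g' p"
  shows "\<bar>prob {\<omega> \<in> space M. sqrt (real n) / \<sigma> * ((\<Sum>i. g (freq i \<omega>)) - (\<Sum>i. g (p i))) \<le> x}
      - cdf std_normal_distribution x\<bar>
    \<le> (K * A + 32 * B + 1) / (real n powr (\<gamma> / 2) * \<sigma> powr (1/2))"
    (is "\<bar>?P - ?F\<bar> \<le> _")
proof -
  define D where "D = real n powr - \<gamma> / \<sigma>"
  define \<delta> where "\<delta> = sqrt D"
  have n0: "0 < real n" using n_pos by simp
  have \<sigma>0: "0 < \<sigma>" using \<sigma> by (simp add: \<sigma>_def)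
  have D0: "0 < D" using n0 \<sigma>0 by (simp add: D_def)
  have \<delta>0: "0 < \<delta>" and \<delta>2: "D = \<delta> * \<delta>" using D0 by (auto simp: \<delta>_def)
  have B0: "0 \<le> B" using B[of 0] by simp
  have \<delta>_eq: "1 / (real n powr (\<gamma> / 2) * \<sigma> powr (1/2)) = \<delta>"
  proof -
    have "\<delta> = (real n powr - \<gamma>) powr (1/2) / \<sigma> powr (1/2)"
      using n0 \<sigma>0 D0 by (simp add: \<delta>_def powr_half_sqrt[symmetric] D_def powr_divide)
    also have "(real n powr - \<gamma>) powr (1/2) = 1 / real n powr (\<gamma> / 2)"
      by (simp add: powr_powr flip: powr_minus_divide)
    finally show ?thesis by simp
  qed
  have "\<bar>?P - ?F\<bar> \<le> (K * A + 32 * B + 1) * \<delta>"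
  \<comment> \<open>For \<delta> > 1 the claim is trivial, since two probabilities differ by at most
    1 and the constant is at least 1.\<close>
  proof (cases "\<delta> \<le> 1")
    case True
    have m: "sqrt (real n) / \<sigma> * K * (A * real n powr - (\<gamma> + 1/2)) = K * A * D"
    proof -
      have "real n powr - \<gamma> = sqrt (real n) * real n powr - (\<gamma> + 1/2)"
        using n0 by (simp add: powr_half_sqrt[symmetric] flip: powr_add)
      then show ?thesis by (simp add: D_def)
    qed
    \<comment> \<open>The only place where \<gamma> <= 1/2 matters: the size of the summands is
      dominated by that of the remainder.\<close>
    have b: "2 * B / (sqrt (real n) * \<sigma>) \<le> 2 * B * D"
    proof -
      have "real n powr - (1/2) \<le> real n powr - \<gamma>"
        using n_pos \<gamma> by (intro powr_mono) auto
      then have "1 / (sqrt (real n) * \<sigma>) \<le> D"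
        using \<sigma>0 n0 by (simp add: D_def powr_minus_divide powr_half_sqrt field_simps)
      then have "2 * B * (1 / (sqrt (real n) * \<sigma>)) \<le> 2 * B * D"
        using B0 by (intro mult_left_mono) auto
      then show ?thesis by simp
    qed
    have "\<bar>?P - ?F\<bar> \<le> sqrt (real n) / \<sigma> * K * (A * real n powr - (\<gamma> + 1/2)) / \<delta>
        + 2 * (2 * B / (sqrt (real n) * \<sigma>)) * (1 / \<delta> + 7) + \<delta>"
      unfolding \<sigma>_def using A(2)
      by (intro kolmogorov_bound_plug_in[OF deriv holder K \<beta> B sum_g A(1) _ \<sigma> \<delta>0]) auto
    also have "\<dots> \<le> K * A * D / \<delta> + 2 * (2 * B * D) * (1 / \<delta> + 7) + \<delta>"
      unfolding m using b \<delta>0 by (intro add_mono mult_right_mono mult_left_mono) auto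
    \<comment> \<open>With D = \<delta>^2 the Stein error splits into 4 * B * \<delta> and 2 * 2 * 7
      * B * \<delta>^2; as \<delta> <= 1 these add up to 32 * B * \<delta>.\<close>
    also have "\<dots> = (K * A + 4 * B + 1) * \<delta> + 28 * B * (\<delta> * \<delta>)"
      unfolding \<delta>2 using \<delta>0 by (simp add: field_simps)
    also have "\<dots> \<le> (K * A + 4 * B + 1) * \<delta> + 28 * B * (\<delta> * 1)"
      using True \<delta>0 B0 by (intro add_left_mono mult_left_mono) auto
    finally show ?thesis by (simp add: algebra_simps)
  next
    case False
    have "0 \<le> ?P" "?P \<le> 1" "0 \<le> ?F" "?F \<le> 1"
      unfolding cdf_def by (rule measure_nonneg prob_le_1 std_normal.prob_le_1)+
    then have "\<bar>?P - ?F\<bar> \<le> 1" by linarith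
    also have "1 \<le> (K * A + 32 * B + 1) * \<delta>"
      using mult_mono[of 1 "K * A + 32 * B + 1" 1 \<delta>] False K A(2) B0 by simp
    finally show ?thesis .
  qed
  also have "\<dots> = (K * A + 32 * B + 1) / (real n powr (\<gamma> / 2) * \<sigma> powr (1/2))"
    by (simp flip: \<delta>_eq)
  finally show ?thesis .
qed

end

section \<open>Constants uniform in n and the final statement\<close>

lemma holder_bounded:
  fixes f :: "real \<Rightarrow> real"
  assumes "\<And>x y. x \<in> {0..1} \<Longrightarrow> y \<in> {0..1} \<Longrightarrow> \<bar>f x - f y\<bar> \<le> K * \<bar>x - y\<bar> powr \<beta>"
    and "0 \<le> K" "0 \<le> \<beta>" "x \<in> {0..1}"
  shows "\<bar>f x\<bar> \<le> \<bar>f 0\<bar> + K"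
proof -
  have "\<bar>f x - f 0\<bar> \<le> K * \<bar>x - 0\<bar> powr \<beta>" using assms(1)[of x 0] assms(4) by simp
  also have "\<dots> \<le> K * 1" using assms by (intro mult_left_mono powr_le1) auto
  finally show ?thesis by linarith
qed

text \<open>Uniformity in n holds because K and B depend on g' alone, while A is 3 or twice the
  supremum of the power sums. That supremum is taken in the extended reals, so a divergent power sum
  violates the hypothesis instead of getting a default value.\<close>

theorem theorem2p1:
  fixes g g' :: "real \<Rightarrow> real" and \<beta> :: real
    and p :: "nat \<Rightarrow> nat \<Rightarrow> real"
    and a :: "nat \<Rightarrow> 'a"
    and M :: "nat \<Rightarrow> 'w measure"
    and X :: "nat \<Rightarrow> nat \<Rightarrow> 'w \<Rightarrow> 'a"
  assumes g_deriv: "\<And>x. x \<in> {0..1} \<Longrightarrow> (g has_real_derivative g' x) (at x within {0..1})"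
    and g'_holder: "holder_on \<beta> {0..1} g'"
    and letters_distinct: "inj a"
    and p_nonneg: "\<And>n i. n \<ge> 1 \<Longrightarrow> 0 \<le> p n i"
    and p_sums: "\<And>n. n \<ge> 1 \<Longrightarrow> p n sums 1"
    and g_summable: "\<And>n. n \<ge> 1 \<Longrightarrow> summable (\<lambda>i. \<bar>g (p n i)\<bar>)"
    and prob_space_M: "\<And>n. n \<ge> 1 \<Longrightarrow> prob_space (M n)"
    and X_indep: "\<And>n. n \<ge> 1 \<Longrightarrow>
        prob_space.indep_vars (M n) (\<lambda>_. count_space (range a)) (X n) {1..n}"
    and X_distr: "\<And>n k i. n \<ge> 1 \<Longrightarrow> k \<in> {1..n} \<Longrightarrow> \<P>(\<omega> in M n. X n k \<omega> = a i) = p n i"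
    and beta_range: "\<beta> \<in> {1/2<..1} \<or>
        \<beta> \<in> {0<..1/2} \<and> (SUP n\<in>{1..}. \<Sum>i. ennreal (p n i powr ((\<beta> + 1) / 2))) < \<infinity>"
  shows "\<exists>C>0. \<forall>n\<ge>1. asymp_sd g' (p n) > 0 \<longrightarrow>
    (SUP x. \<bar>\<P>(\<omega> in M n. sqrt (real n) / asymp_sd g' (p n)
                  * (plug_in g a n (X n) \<omega> - additive_functional g (p n)) \<le> x)
              - cdf std_normal_distribution x\<bar>)
      \<le> C / (real n powr (rate_exponent \<beta> / 2) * asymp_sd g' (p n) powr (1/2))"
proof -
  obtain K where K: "0 < K"
    and holder: "\<And>x y. x \<in> {0..1} \<Longrightarrow> y \<in> {0..1} \<Longrightarrow> \<bar>g' x - g' y\<bar> \<le> K * \<bar>x - y\<bar> powr \<beta>"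
    and \<beta>: "0 < \<beta>" "\<beta> \<le> 1"
    using g'_holder unfolding holder_on_def by blast
  define B where "B = \<bar>g' 0\<bar> + K"
  define \<gamma> where "\<gamma> = rate_exponent \<beta>"
  \<comment> \<open>\<open>inv a\<close> is meaningful only on \<open>range a\<close>; measurability
    into \<open>count_space (range a)\<close> keeps the observations there for every \<omega> in the
    space.\<close>
  define J where "J n k \<omega> = inv a (X n k \<omega>)" for n k \<omega>
  have B: "\<bar>g' x\<bar> \<le> B" if "x \<in> {0..1}" for x
    unfolding B_def by (rule holder_bounded[OF holder]) (use K \<beta> that in auto)
  have B0: "0 \<le> B" using K by (simp add: B_def)
  have \<gamma>_le: "\<gamma> \<le> 1/2" using \<beta> by (simp add: \<gamma>_def rate_exponent_def)
  have sample: "discrete_sample (M n) n (J n) (p n)"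
    and X_range: "\<And>k \<omega>. k \<in> {1..n} \<Longrightarrow> \<omega> \<in> space (M n) \<Longrightarrow> X n k \<omega> \<in> range a" if n: "1 \<le> n" for n
  proof -
    interpret prob_space "M n" by (rule prob_space_M[OF n])
    have "X n k \<in> measurable (M n) (count_space (range a))" if "k \<in> {1..n}" for k
      using X_indep[OF n] that by (auto simp: indep_vars_def)
    then show X_range: "\<And>k \<omega>. k \<in> {1..n} \<Longrightarrow> \<omega> \<in> space (M n) \<Longrightarrow> X n k \<omega> \<in> range a"
      by (metis measurable_space space_count_space)
    show "discrete_sample (M n) n (J n) (p n)"
    proof
      show "indep_vars (\<lambda>_. count_space UNIV) (J n) {1..n}"
        unfolding J_def[abs_def] by (rule indep_vars_compose2[OF X_indep[OF n]]) simp
      show "prob {\<omega> \<in> space (M n). J n k \<omega> = i} = p n i" if k: "k \<in> {1..n}" for k i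
      proof -
        have "J n k \<omega> = i \<longleftrightarrow> X n k \<omega> = a i" if "\<omega> \<in> space (M n)" for \<omega>
          using X_range[OF k that] letters_distinct unfolding J_def by (metis f_inv_into_f inv_f_f)
        then have "{\<omega> \<in> space (M n). J n k \<omega> = i} = {\<omega> \<in> space (M n). X n k \<omega> = a i}" by auto
        then show ?thesis using X_distr[OF n k] by simp
      qed
    qed (use n in auto)
  qed
  have "\<exists>A\<ge>0. \<forall>n\<ge>1. (\<Sum>i. \<integral>\<^sup>+\<omega>. ennreal (\<bar>discrete_sample.freq n (J n) i \<omega> - p n i\<bar> powr (1 + \<beta>)) \<partial>M n)
      \<le> ennreal (A * real n powr - (\<gamma> + 1/2))"
    using beta_range
  proof
    assume "\<beta> \<in> {1/2<..1}"
    then have "\<gamma> + 1/2 = \<beta>" by (simp add: \<gamma>_def rate_exponent_def)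
    then show ?thesis using discrete_sample.moment_sum_large[OF sample \<beta>] by (intro exI[of _ 3]) simp
  next
    assume *: "\<beta> \<in> {0<..1/2} \<and> (SUP n\<in>{1..}. \<Sum>i. ennreal (p n i powr ((\<beta> + 1) / 2))) < \<infinity>"
    define S where "S = (SUP n\<in>{1..}. \<Sum>i. ennreal (p n i powr ((\<beta> + 1) / 2)))"
    \<comment> \<open>Finiteness of the supremum turns it into a real constant valid for all n at
      once.\<close>
    have "S = ennreal (enn2real S)" using * by (simp add: S_def less_top)
    then have "(\<Sum>i. ennreal (p n i powr ((\<beta> + 1) / 2))) \<le> ennreal (enn2real S)" if "1 \<le> n" for n
      using that by (auto simp: S_def intro!: SUP_upper2)
    note bound = discrete_sample.moment_sum_small[OF sample \<beta> this]
    have "\<gamma> + 1/2 = (1 + \<beta>) / 2" using * by (simp add: \<gamma>_def rate_exponent_def)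
    show ?thesis unfolding \<open>\<gamma> + 1/2 = (1 + \<beta>) / 2\<close>
      using bound by (intro exI[of _ "2 * enn2real S"]) simp
  qed
  then obtain A where A: "0 \<le> A" and moment: "\<And>n. 1 \<le> n \<Longrightarrow>
      (\<Sum>i. \<integral>\<^sup>+\<omega>. ennreal (\<bar>discrete_sample.freq n (J n) i \<omega> - p n i\<bar> powr (1 + \<beta>)) \<partial>M n)
      \<le> ennreal (A * real n powr - (\<gamma> + 1/2))"
    by blast
  have bound: "\<bar>\<P>(\<omega> in M n. sqrt (real n) / asymp_sd g' (p n)
                  * (plug_in g a n (X n) \<omega> - additive_functional g (p n)) \<le> x)
              - cdf std_normal_distribution x\<bar>
      \<le> (K * A + 32 * B + 1) / (real n powr (\<gamma> / 2) * asymp_sd g' (p n) powr (1/2))"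
    if n: "1 \<le> n" and \<sigma>: "0 < asymp_sd g' (p n)" for n x
  proof -
    interpret discrete_sample "M n" n "J n" "p n" by (rule sample[OF n])
    \<comment> \<open>Outside the space the two frequencies may differ; agreement on it suffices
      because the event is a subset of the space.\<close>
    have "emp_prob a n (X n) \<omega> i = freq i \<omega>" if \<omega>: "\<omega> \<in> space (M n)" for \<omega> i
    proof -
      have "X n k \<omega> = a i \<longleftrightarrow> J n k \<omega> = i" if "k \<in> {1..n}" for k
        using X_range[OF n that \<omega>] letters_distinct unfolding J_def by (metis f_inv_into_f inv_f_f)
      then have "(\<Sum>k=1..n. indicat_real {\<omega>. X n k \<omega> = a i} \<omega>) = (\<Sum>k=1..n. indicator {i} (J n k \<omega>))"
        by (intro sum.cong) (auto simp: indicator_def)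
      then show ?thesis by (simp add: emp_prob_def freq_def)
    qed
    then have "{\<omega> \<in> space (M n). sqrt (real n) / asymp_sd g' (p n)
          * (plug_in g a n (X n) \<omega> - additive_functional g (p n)) \<le> x}
        = {\<omega> \<in> space (M n). sqrt (real n) / asymp_sd g' (p n)
          * ((\<Sum>i. g (freq i \<omega>)) - (\<Sum>i. g (p n i))) \<le> x}"
      by (auto simp: plug_in_def additive_functional_def)
    then show ?thesis
      using kolmogorov_rate_plug_in[OF g_deriv holder _ \<beta>(1) B g_summable[OF n] moment[OF n] A \<gamma>_le \<sigma>] K
      by simp
  qed
  show ?thesis
  proof (intro exI[of _ "K * A + 32 * B + 1"] conjI allI impI)
    show "0 < K * A + 32 * B + 1" using K A B0 by (simp add: add_nonneg_pos)
    show "(SUP x. \<bar>\<P>(\<omega> in M n. sqrt (real n) / asymp_sd g' (p n)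
                  * (plug_in g a n (X n) \<omega> - additive_functional g (p n)) \<le> x)
              - cdf std_normal_distribution x\<bar>)
      \<le> (K * A + 32 * B + 1) / (real n powr (rate_exponent \<beta> / 2) * asymp_sd g' (p n) powr (1/2))"
      if "1 \<le> n" "0 < asymp_sd g' (p n)" for n
      using bound[OF that] unfolding \<gamma>_def by (intro cSUP_least) auto
  qed
qed

end
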